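(* Fix $\underline\omega\in\Omega=\mathbb Z^{\mathbb Z}$. Consider the family $\{\underline\omega^{[\ell,\mathfrak r]}(t): -\infty<\ell<\mathfrak r<\infty\}$ of all $[\ell,\mathfrak r]$-monotone processes with the common initial state $\underline\omega$, and let $h_i^{[\ell,\mathfrak r]}(t)$ be the height of column $i$ of $\underline\omega^{[\ell,\mathfrak r]}(t)$ at time $t$, with the initial normalization $h_0^{[\ell,\mathfrak r]}(0)=0$. Then there is a coupling of all these processes such that, almost surely, for all integers $\mathcal L\le\ell<0<\mathfrak r\le\mathcal R$, $$h_i^{[\ell,\mathfrak r]}(t)\le h_i^{[\mathcal L,\mathcal R]}(t)\quad\text{for all } i\in\mathbb Z \text{ and } 0\le t<\infty .$$ Consequently, the monotone nondecreasing limits $$h_i(t):=\lim_{[\ell,\mathfrak r]\nearrow\mathbb Z}h_i^{[\ell,\mathfrak r]}(t)=\sup_{[\ell,\mathfrak r]\subseteq\mathbb Z}h_i^{[\ell,\mathfrak r]}(t)$$ exist almost surely for all $i\in\mathbb Z$ and $0\le t<\infty$ (the value $h_i(t)=\infty$ being allowed).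
   Context: Rate function: $r:\mathbb Z\to(0,\infty)$ is fixed, strictly increasing, satisfies $r(z)\,r(1-z)=1$ for all $z\in\mathbb Z$, $\lim_{z\to\infty}r(z)=\infty$, and there is $\beta>0$ with $r(z)<e^{\beta z}$ for all $z>0$. Configurations: for $\underline\omega=(\omega_i)_{i\in\mathbb Z}\in\Omega=\mathbb Z^{\mathbb Z}$, the configuration $\underline\omega^{(i,i+1)}$ is obtained from $\underline\omega$ by replacing $\omega_i$ by $\omega_i-1$ and $\omega_{i+1}$ by $\omega_{i+1}+1$. Heights $\underline h=(h_i)_{i\in\mathbb Z}$ are related to increments by $\omega_i=h_{i-1}-h_i$. The jump $\underline\omega\to\underline\omega^{(i,i+1)}$ corresponds to $h_i\to h_i+1$. Monotone process: for integers $\ell<\mathfrak r$, the $[\ell,\mathfrak r]$-monotone process is the (non-explosive) continuous-time Markov jump process in which, for each $\ell\le i\le\mathfrak r-1$ independently, the jump $\underline\omega\to\underline\omega^{(i,i+1)}$ (equivalently $h_i\to h_i+1$) happens at rate $r(\omega_i)+r(-\omega_{i+1})$, and no other jumps occur (all columns $h_i$ with $i\notin\{\ell,\dots,\mathfrak r-1\}$ are frozen). *)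

theory Defs
  imports "HOL-Probability.Probability"
begin

type_synonym config = "int \<Rightarrow> int"

definition config_space :: "config measure" where
  "config_space = PiM UNIV (\<lambda>_. count_space UNIV)"

text \<open>The configuration obtained from \<eta> by the jump across (i,i+1): a brick is laid on column i.\<close>

definition lay_brick :: "int \<Rightarrow> config \<Rightarrow> config" where
  "lay_brick i \<eta> = \<eta>(i := \<eta> i - 1, i + 1 := \<eta> (i + 1) + 1)"

text \<open>
  Continuous-time Markov jump processes via jump chain and holding times. \<^term>\<open>q x y\<close> is the rate of
  the jump from x to y (for x different from y; the diagonal of q is 0). The definition is meant for
  chains with summable rates and without absorbing states. Each state then has countably many
  possible successors, whose transition probabilities add up to 1, so that the probabilities in
  \<open>jump_chain\<close> determine the law of the chain even on an uncountable state space.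
\<close>

definition exit_rate :: "('s \<Rightarrow> 's \<Rightarrow> real) \<Rightarrow> 's \<Rightarrow> real" where
  "exit_rate q x = (\<Sum>\<^sub>\<infinity>y. q x y)"

definition jump_chain ::
  "'a measure \<Rightarrow> 's measure \<Rightarrow> ('s \<Rightarrow> 's \<Rightarrow> real) \<Rightarrow> 's \<Rightarrow> (nat \<Rightarrow> 'a \<Rightarrow> 's) \<Rightarrow> bool" where
  "jump_chain M N q x0 Y \<longleftrightarrow>
     (\<forall>n. Y n \<in> M \<rightarrow>\<^sub>M N) \<and>
     (\<forall>n x. measure M {w \<in> space M. \<forall>k\<le>n. Y k w = x k} =
        (if x 0 = x0 then \<Prod>k<n. q (x k) (x (Suc k)) / exit_rate q (x k) else 0))"

text \<open>
  Conditionally on the jump chain Y, the times S 0, S 1, ... spent in Y 0, Y 1, ... are independent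
  and exponentially distributed with parameters given by the exit rates. As the chain is discrete,
  it suffices to give the joint survival function on each event fixing the first states.
\<close>

definition holding_times ::
  "'a measure \<Rightarrow> ('s \<Rightarrow> 's \<Rightarrow> real) \<Rightarrow> (nat \<Rightarrow> 'a \<Rightarrow> 's) \<Rightarrow> (nat \<Rightarrow> 'a \<Rightarrow> real) \<Rightarrow> bool" where
  "holding_times M q Y S \<longleftrightarrow>
     (\<forall>n. S n \<in> borel_measurable M) \<and>
     (\<forall>n x s. (\<forall>k\<le>n. 0 \<le> s k) \<longrightarrow>
        measure M {w \<in> space M. \<forall>k\<le>n. Y k w = x k \<and> s k < S k w} =
        measure M {w \<in> space M. \<forall>k\<le>n. Y k w = x k} * (\<Prod>k\<le>n. exp (- exit_rate q (x k) * s k)))"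

text \<open>
  The n-th jump occurs at time S 0 + ... + S (n - 1); the divergence of these times is non-explosion.
\<close>

definition markov_jump_process ::
  "'a measure \<Rightarrow> 's measure \<Rightarrow> ('s \<Rightarrow> 's \<Rightarrow> real) \<Rightarrow> 's \<Rightarrow> (real \<Rightarrow> 'a \<Rightarrow> 's) \<Rightarrow> bool" where
  "markov_jump_process M N q x0 X \<longleftrightarrow>
     (\<forall>t\<ge>0. X t \<in> M \<rightarrow>\<^sub>M N) \<and>
     (\<exists>Y S. jump_chain M N q x0 Y \<and> holding_times M q Y S \<and>
        (AE w in M. filterlim (\<lambda>n. \<Sum>k<n. S k w) at_top sequentially) \<and>
        (AE w in M. \<forall>t\<ge>0. \<forall>n. (\<Sum>k<n. S k w) \<le> t \<and> t < (\<Sum>k<Suc n. S k w) \<longrightarrow> X t w = Y n w))"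

text \<open>
  Different columns lead to different configurations, so the sum has at most one term.
\<close>

definition monotone_rate :: "(int \<Rightarrow> real) \<Rightarrow> int \<Rightarrow> int \<Rightarrow> config \<Rightarrow> config \<Rightarrow> real" where
  "monotone_rate r l u \<eta> \<eta>' =
     (\<Sum>i \<in> {i. l \<le> i \<and> i \<le> u - 1 \<and> \<eta>' = lay_brick i \<eta>}. r (\<eta> i) + r (- \<eta> (i + 1)))"

definition monotone_process ::
  "'a measure \<Rightarrow> (int \<Rightarrow> real) \<Rightarrow> int \<Rightarrow> int \<Rightarrow> config \<Rightarrow> (real \<Rightarrow> 'a \<Rightarrow> config) \<Rightarrow> bool" where
  "monotone_process M r l u \<eta> X \<longleftrightarrow>
     markov_jump_process M config_space (monotone_rate r l u) \<eta> X"

text \<open>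
  The heights h with increments h (i - 1) - h i = \<eta> i whose column k has height c.
\<close>

definition heights :: "int \<Rightarrow> int \<Rightarrow> config \<Rightarrow> int \<Rightarrow> int" where
  "heights k c \<eta> i = (if k \<le> i then c - (\<Sum>j\<in>{k<..i}. \<eta> j) else c + (\<Sum>j\<in>{i<..k}. \<eta> j))"

lemma heights_anchor: "heights k c \<eta> k = c"
  by (simp add: heights_def)

lemma heights_increment: "heights k c \<eta> (i - 1) - heights k c \<eta> i = \<eta> i"
proof -
  consider "k < i" | "k = i" | "i < k" by linarith
  then show ?thesis
  proof cases
    case 1
    then have "{k<..i} = insert i {k<..i - 1}" by auto
    with 1 show ?thesis by (simp add: heights_def)
  next
    case 2
    have "{k - 1<..k} = {k}" by auto
    with 2 show ?thesis by (simp add: heights_def)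
  next
    case 3
    then have "{i - 1<..k} = insert i {i<..k}" by auto
    with 3 show ?thesis by (simp add: heights_def)
  qed
qed

lemma heights_unique:
  assumes "g k = c" and "\<And>i. g (i - 1) - g i = \<eta> i"
  shows "g = heights k c \<eta>"
proof
  fix i
  show "g i = heights k c \<eta> i"
  proof (induction i rule: int_induct[where k = k])
    case base
    show ?case using assms(1) by (simp add: heights_anchor)
  next
    case (step1 i)
    show ?case
      using step1(2) assms(2)[of "i + 1"] heights_increment[of k c \<eta> "i + 1"] by simp
  next
    case (step2 i)
    show ?case
      using step2(2) assms(2)[of i] heights_increment[of k c \<eta> i] by simp
  qed
qed

lemma heights_lay_brick:
  assumes "i \<noteq> k"
  shows "heights k c (lay_brick i \<eta>) = (heights k c \<eta>)(i := heights k c \<eta> i + 1)"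
proof -
  have "((heights k c \<eta>)(i := heights k c \<eta> i + 1)) (j - 1) -
        ((heights k c \<eta>)(i := heights k c \<eta> i + 1)) j = lay_brick i \<eta> j" for j
    using heights_increment[of k c \<eta> j] by (auto simp: lay_brick_def)
  with assms show ?thesis
    by (intro heights_unique[symmetric]) (auto simp: heights_anchor)
qed

text \<open>
  Heights when the monotone process on [l,u] that started from \<eta>0 is in state \<eta>. Initially column 0
  has height 0. Column 0 may grow later on, so the heights are recovered from the increments at
  column l - 1, which is frozen.
\<close>

definition column_height :: "config \<Rightarrow> int \<Rightarrow> config \<Rightarrow> int \<Rightarrow> int" where
  "column_height \<eta>0 l \<eta> = heights (l - 1) (heights 0 0 \<eta>0 (l - 1)) \<eta>"

lemma column_height_initial: "column_height \<eta> l \<eta> = heights 0 0 \<eta>"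
  unfolding column_height_def
  by (rule heights_unique[symmetric]) (auto simp: heights_increment)

end

theory Submission
  imports Defs
begin

text \<open>
  Attach independent Exp(1) clocks \<open>w (i, k)\<close> to all columns i and levels k, and let every process use
  the same clocks: column i leaves level k when its jump rate, integrated over the time it has spent
  at level k, exceeds \<open>w (i, k)\<close>. By the lack of memory of the clocks this gives the monotone process
  on each interval.

  In a larger interval the neighbours of a column are higher at all times. As r is increasing, the
  column then starts each level earlier and runs down its clock faster, so it leaves the level
  earlier. Comparing the two paths jump by jump turns this into an induction.

  A process does not explode: a column that raises the maximal height M has rate at most
  \<open>2 * r 0\<close> at level M. So each M for which all clocks at level M exceed 1 costs time at least
  \<open>1 / (2 * r 0)\<close>, and almost surely there are infinitely many such M.
\<close>

section \<open>Exponential clocks\<close>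

text \<open>Labelling the clocks by level makes a column use the same clock for a level in every
  system, whenever it gets there. The order of two systems can break only at a column that is
  equally high in both, and there both are running down the same clock.

  The law of a path is found by splitting off its first jump. The obstacle is that the clocks left
  over after the jump do not have the product law, since the one that rang is at 0. The future path
  does not depend on that clock, so for events of the future the leftover clocks may be replaced by
  fresh ones.\<close>

type_synonym clocks = "int \<times> int \<Rightarrow> real"

definition exp_dist :: "real measure" where
  "exp_dist = density lborel (exponential_density 1)"

definition clock_space :: "clocks measure" where
  "clock_space = PiM UNIV (\<lambda>_. exp_dist)"

lemma sets_exp_dist [measurable_cong, simp]: "sets exp_dist = sets borel"
  by (simp add: exp_dist_def)

lemma space_exp_dist [simp]: "space exp_dist = UNIV"
  by (simp add: exp_dist_def)

interpretation exp_dist: prob_space exp_dist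
  unfolding exp_dist_def by (rule prob_space_exponential_density) simp

interpretation clock_space: prob_space clock_space
  unfolding clock_space_def by (intro prob_space_PiM exp_dist.prob_space_axioms)

lemma sets_clock_space [measurable_cong]: "sets clock_space = sets (PiM UNIV (\<lambda>_. borel))"
  unfolding clock_space_def by (intro sets_PiM_cong) auto

lemma space_clock_space [simp]: "space clock_space = UNIV"
  by (simp add: clock_space_def space_PiM)

lemma measurable_clock: "(\<lambda>w. w c) \<in> borel_measurable clock_space"
  using measurable_component_singleton[of c UNIV "\<lambda>_. borel"]
  by (simp cong: measurable_cong_sets add: sets_clock_space)

lemma measurable_into_clock_space:
  assumes "\<And>c. (\<lambda>x. f x c) \<in> borel_measurable M"
  shows "f \<in> M \<rightarrow>\<^sub>M clock_space"
proof -
  have "(\<lambda>x. \<lambda>c\<in>UNIV. f x c) \<in> M \<rightarrow>\<^sub>M PiM UNIV (\<lambda>_. borel)"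
    using assms by (intro measurable_restrict) auto
  then show ?thesis
    by (simp cong: measurable_cong_sets add: sets_clock_space restrict_def)
qed

section \<open>Lack of memory of a single clock\<close>

lemma nn_integral_exp_dist:
  assumes [measurable]: "f \<in> borel_measurable borel"
  shows "(\<integral>\<^sup>+a. f a \<partial>exp_dist) = (\<integral>\<^sup>+a. ennreal (exp (- a)) * f a * indicator {0..} a \<partial>lborel)"
  unfolding exp_dist_def
  by (subst nn_integral_density)
     (auto simp: exponential_density_def ac_simps split: split_indicator intro!: nn_integral_cong)

lemma AE_exp_dist_pos: "AE a in exp_dist. 0 < a"
proof -
  have "AE a in lborel. a \<noteq> (0::real)"
    by (rule AE_lborel_singleton)
  then show ?thesis
    unfolding exp_dist_def
    by (subst AE_density) (auto simp: exponential_density_def elim!: eventually_mono)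
qed

lemma AE_clock_pos: "AE w in clock_space. \<forall>c. 0 < w c"
  unfolding AE_all_countable clock_space_def
  by (intro allI AE_PiM_component exp_dist.prob_space_axioms AE_exp_dist_pos) auto

text \<open>Translating the density \<open>exp (- a)\<close> by \<open>b\<close> costs the factor
  \<open>exp (- b)\<close>, so what is left of a clock that survived \<open>b\<close> is again
  Exp(1). The half-line may be open or closed because a point has measure zero.\<close>

lemma exp_dist_memoryless:
  assumes [measurable]: "f \<in> borel_measurable borel" "B \<in> sets borel"
    and B: "{b<..} \<subseteq> B" "B \<subseteq> {b..}" and "0 \<le> b"
  shows "(\<integral>\<^sup>+a. (if a \<in> B then f (a - b) else 0) \<partial>exp_dist) = ennreal (exp (- b)) * (\<integral>\<^sup>+a. f a \<partial>exp_dist)"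
proof -
  have "(\<integral>\<^sup>+a. (if a \<in> B then f (a - b) else 0) \<partial>exp_dist) =
      (\<integral>\<^sup>+a. ennreal (exp (- a)) * (if a \<in> B then f (a - b) else 0) * indicator {0..} a \<partial>lborel)"
    by (rule nn_integral_exp_dist) measurable
  also have "\<dots> = (\<integral>\<^sup>+a. ennreal (exp (- a)) * f (a - b) * indicator {b..} a \<partial>lborel)"
  proof (rule nn_integral_cong_AE)
    have "AE a in lborel. a \<noteq> b"
      by (rule AE_lborel_singleton)
    then show "AE a in lborel. ennreal (exp (- a)) * (if a \<in> B then f (a - b) else 0) * indicator {0..} a =
        ennreal (exp (- a)) * f (a - b) * indicator {b..} a"
    proof (eventually_elim)
      case (elim a)
      then have "a \<in> B \<longleftrightarrow> b \<le> a" using B by (force simp: le_less)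
      then show ?case using \<open>0 \<le> b\<close> by (auto split: split_indicator)
    qed
  qed
  also have "\<dots> = (\<integral>\<^sup>+a. ennreal (exp (- (b + a))) * f a * indicator {0..} a \<partial>lborel)"
    by (subst nn_integral_real_affine[where c = 1 and t = b])
       (auto simp: indicator_def intro!: nn_integral_cong)
  also have "\<dots> = (\<integral>\<^sup>+a. ennreal (exp (- b)) * (ennreal (exp (- a)) * f a * indicator {0..} a) \<partial>lborel)"
    by (intro nn_integral_cong) (simp add: exp_add[symmetric] ennreal_mult[symmetric] mult.assoc[symmetric])
  also have "\<dots> = ennreal (exp (- b)) * (\<integral>\<^sup>+a. ennreal (exp (- a)) * f a * indicator {0..} a \<partial>lborel)"
    by (rule nn_integral_cmult) measurable
  also have "(\<integral>\<^sup>+a. ennreal (exp (- a)) * f a * indicator {0..} a \<partial>lborel) = (\<integral>\<^sup>+a. f a \<partial>exp_dist)"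
    by (rule nn_integral_exp_dist[symmetric]) measurable
  finally show ?thesis .
qed

text \<open>Used in \<open>first_jump\<close>: if the clock of the ringing column has value
  \<open>a\<close>, the other columns survive until it rings with probability
  \<open>exp (- (k * a))\<close>, where \<open>k\<close> is their total rate relative to that of the
  ringing column.\<close>

lemma exp_dist_exp_integral:
  assumes "0 \<le> b" "0 \<le> k"
  shows "(\<integral>\<^sup>+a. (if b < a then ennreal (exp (- (k * a))) else 0) \<partial>exp_dist) = ennreal (exp (- ((1 + k) * b)) / (1 + k))"
proof -
  have "(\<integral>\<^sup>+a. (if b < a then ennreal (exp (- (k * a))) else 0) \<partial>exp_dist) =
     (\<integral>\<^sup>+a. ennreal (exp (- a)) * (if b < a then ennreal (exp (- (k * a))) else 0) * indicator {0..} a \<partial>lborel)"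
    by (rule nn_integral_exp_dist) measurable
  also have "\<dots> = (\<integral>\<^sup>+a. ennreal (exp (- ((1 + k) * a))) * indicator {b..} a \<partial>lborel)"
  proof (rule nn_integral_cong_AE)
    have "AE a in lborel. a \<noteq> b"
      by (rule AE_lborel_singleton)
    then show "AE a in lborel. ennreal (exp (- a)) * (if b < a then ennreal (exp (- (k * a))) else 0) * indicator {0..} a
        = ennreal (exp (- ((1 + k) * a))) * indicator {b..} a"
      by eventually_elim
         (use \<open>0 \<le> b\<close> in \<open>auto split: split_indicator simp: ennreal_mult[symmetric] exp_add[symmetric] algebra_simps\<close>)
  qed
  also have "\<dots> = ennreal (0 - (- exp (- ((1 + k) * b)) / (1 + k)))"
  proof (rule nn_integral_FTC_atLeast)
    fix x show "((\<lambda>x. - exp (- ((1 + k) * x)) / (1 + k)) has_field_derivative exp (- ((1 + k) * x))) (at x)"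
      using assms by (auto intro!: derivative_eq_intros simp: divide_simps) (simp add: algebra_simps)
    have "filterlim (\<lambda>x. (1 + k) * x) at_top at_top"
      using assms by (intro filterlim_tendsto_pos_mult_at_top[OF tendsto_const]) (auto simp: filterlim_ident)
    then have "((\<lambda>x. exp (- ((1 + k) * x))) \<longlongrightarrow> 0) at_top"
      by (intro filterlim_compose[OF exp_at_bot]) (simp only: filterlim_uminus_at_bot minus_minus)
    then show "((\<lambda>x. - exp (- ((1 + k) * x)) / (1 + k)) \<longlongrightarrow> 0) at_top"
      using tendsto_divide[OF tendsto_minus tendsto_const, of _ 0 at_top "1 + k"] assms by simp
  qed auto
  finally show ?thesis by simp
qed

section \<open>Resampling one clock, and lack of memory of finitely many clocks\<close>

lemma measurable_resample [measurable]:
  "(\<lambda>(a, w). w(c := a)) \<in> exp_dist \<Otimes>\<^sub>M clock_space \<rightarrow>\<^sub>M clock_space"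
  "(\<lambda>a. w(c := a)) \<in> borel \<rightarrow>\<^sub>M clock_space"
proof -
  show "(\<lambda>(a, w). w(c := a)) \<in> exp_dist \<Otimes>\<^sub>M clock_space \<rightarrow>\<^sub>M clock_space"
  proof (rule measurable_into_clock_space)
    fix d show "(\<lambda>x. (case x of (a, w) \<Rightarrow> w(c := a)) d) \<in> borel_measurable (exp_dist \<Otimes>\<^sub>M clock_space)"
      by (cases "c = d") (auto simp: split_beta intro: measurable_compose[OF measurable_snd measurable_clock])
  qed
  show "(\<lambda>a. w(c := a)) \<in> borel \<rightarrow>\<^sub>M clock_space"
    by (rule measurable_into_clock_space) (simp add: fun_upd_def)
qed

lemma clock_space_resample: "distr (exp_dist \<Otimes>\<^sub>M clock_space) clock_space (\<lambda>(a, w). w(c := a)) = clock_space"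
  using distr_pair_PiM_eq_PiM[of UNIV "\<lambda>_. exp_dist" c] exp_dist.prob_space_axioms
  by (simp add: clock_space_def)

text \<open>Fubini for one factor of the infinite product. The first form fixes the other clocks, as
  in the induction for \<open>clock_space_memoryless\<close>. The second fixes the clock
  \<open>c\<close>, as in \<open>first_jump\<close>, where its value determines the time of the
  jump.\<close>

lemma nn_integral_resample:
  assumes [measurable]: "f \<in> borel_measurable clock_space"
  shows "(\<integral>\<^sup>+w. f w \<partial>clock_space) = (\<integral>\<^sup>+w. \<integral>\<^sup>+a. f (w(c := a)) \<partial>exp_dist \<partial>clock_space)"
    and "(\<integral>\<^sup>+w. f w \<partial>clock_space) = (\<integral>\<^sup>+a. \<integral>\<^sup>+w. f (w(c := a)) \<partial>clock_space \<partial>exp_dist)"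
proof -
  interpret P: pair_sigma_finite exp_dist clock_space ..
  have [measurable]: "(\<lambda>(a, w). f (w(c := a))) \<in> borel_measurable (exp_dist \<Otimes>\<^sub>M clock_space)"
    using measurable_compose[OF measurable_resample(1) assms] by (simp add: split_beta)
  have "(\<integral>\<^sup>+w. f w \<partial>clock_space) = (\<integral>\<^sup>+(a, w). f (w(c := a)) \<partial>(exp_dist \<Otimes>\<^sub>M clock_space))"
    by (subst clock_space_resample[of c, symmetric], subst nn_integral_distr)
       (auto simp: split_beta intro!: nn_integral_cong)
  then show "(\<integral>\<^sup>+w. f w \<partial>clock_space) = (\<integral>\<^sup>+w. \<integral>\<^sup>+a. f (w(c := a)) \<partial>exp_dist \<partial>clock_space)"
    and "(\<integral>\<^sup>+w. f w \<partial>clock_space) = (\<integral>\<^sup>+a. \<integral>\<^sup>+w. f (w(c := a)) \<partial>clock_space \<partial>exp_dist)"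
    using P.nn_integral_snd[of "\<lambda>(a, w). f (w(c := a))"]
      clock_space.nn_integral_fst[of "\<lambda>(a, w). f (w(c := a))" exp_dist]
    by simp_all
qed

definition run_down :: "'c set \<Rightarrow> ('c \<Rightarrow> real) \<Rightarrow> ('c \<Rightarrow> real) \<Rightarrow> 'c \<Rightarrow> real" where
  "run_down C b w c = (if c \<in> C then w c - b c else w c)"

lemma measurable_run_down [measurable]: "run_down C b \<in> clock_space \<rightarrow>\<^sub>M clock_space"
  by (rule measurable_into_clock_space) (simp add: run_down_def measurable_clock)

text \<open>
  The sets B c are open or closed half-lines, since ties between clocks are broken in favour of the
  leftmost column.
\<close>

lemma clock_space_memoryless:
  assumes "finite C" and [measurable]: "f \<in> borel_measurable clock_space"
    and [measurable]: "\<And>c. B c \<in> sets borel"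
    and B: "\<And>c. c \<in> C \<Longrightarrow> {b c<..} \<subseteq> B c" "\<And>c. c \<in> C \<Longrightarrow> B c \<subseteq> {b c..}"
    and b: "\<And>c. c \<in> C \<Longrightarrow> 0 \<le> b c"
  shows "(\<integral>\<^sup>+w. (if \<forall>c\<in>C. w c \<in> B c then f (run_down C b w) else 0) \<partial>clock_space) =
    ennreal (exp (- (\<Sum>c\<in>C. b c))) * (\<integral>\<^sup>+w. f w \<partial>clock_space)"
  using assms(1) B b
proof (induction C rule: finite_induct)
  case empty
  have "run_down {} b = id" by (simp add: run_down_def fun_eq_iff)
  then show ?case by simp
next
  case (insert c C)
  let ?D = "insert c C"
  let ?g = "\<lambda>C w. if \<forall>c\<in>C. w c \<in> B c then f (run_down C b w) else 0"
  have fin [measurable]: "Measurable.pred clock_space (\<lambda>w. \<forall>c\<in>C. w c \<in> B c)" "Measurable.pred clock_space (\<lambda>w. \<forall>c\<in>?D. w c \<in> B c)"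
    using insert(1) by (auto intro!: pred_intros_finite measurable_sets_Collect[OF measurable_clock])
  have [measurable]: "?g C \<in> borel_measurable clock_space" "?g ?D \<in> borel_measurable clock_space"
    by measurable
  have "(\<integral>\<^sup>+w. ?g ?D w \<partial>clock_space) = (\<integral>\<^sup>+w. \<integral>\<^sup>+a. ?g ?D (w(c := a)) \<partial>exp_dist \<partial>clock_space)"
    by (rule nn_integral_resample) fact
  also have "\<dots> = (\<integral>\<^sup>+w. \<integral>\<^sup>+a. (if a \<in> B c then ?g C (w(c := a - b c)) else 0) \<partial>exp_dist \<partial>clock_space)"
  proof (intro nn_integral_cong)
    fix w :: clocks and a :: real
    \<comment> \<open>Running down \<open>c\<close> is a shift of its resampled value by
      \<open>b c\<close>. The inner integral is thus a matter for one clock, and \<open>C\<close> is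
      left to the induction hypothesis.\<close>
    have "run_down ?D b (w(c := a)) = run_down C b (w(c := a - b c))"
      using insert(2) by (auto simp: run_down_def)
    then show "?g ?D (w(c := a)) = (if a \<in> B c then ?g C (w(c := a - b c)) else 0)"
      using insert(2) by auto
  qed
  also have "\<dots> = (\<integral>\<^sup>+w. ennreal (exp (- b c)) * (\<integral>\<^sup>+a. ?g C (w(c := a)) \<partial>exp_dist) \<partial>clock_space)"
    using insert.prems measurable_compose[OF measurable_resample(2), of "?g C"]
    by (intro nn_integral_cong exp_dist_memoryless) simp_all
  also have "\<dots> = ennreal (exp (- b c)) * (\<integral>\<^sup>+w. \<integral>\<^sup>+a. ?g C (w(c := a)) \<partial>exp_dist \<partial>clock_space)"
  proof (rule nn_integral_cmult)
    have [measurable]: "(\<lambda>(w, a). ?g C (w(c := a))) \<in> borel_measurable (clock_space \<Otimes>\<^sub>M exp_dist)"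
      using measurable_compose[OF measurable_compose[OF measurable_pair_swap' measurable_resample(1)], of "?g C"]
      by (simp add: split_beta)
    show "(\<lambda>w. \<integral>\<^sup>+a. ?g C (w(c := a)) \<partial>exp_dist) \<in> borel_measurable clock_space"
      by (rule exp_dist.borel_measurable_nn_integral) simp
  qed
  also have "(\<integral>\<^sup>+w. \<integral>\<^sup>+a. ?g C (w(c := a)) \<partial>exp_dist \<partial>clock_space) = (\<integral>\<^sup>+w. ?g C w \<partial>clock_space)"
    by (rule nn_integral_resample(1)[symmetric]) fact
  also have "\<dots> = ennreal (exp (- (\<Sum>c\<in>C. b c))) * (\<integral>\<^sup>+w. f w \<partial>clock_space)"
    using insert by auto
  finally show ?case
    using insert(1,2) by (simp add: mult.assoc[symmetric] ennreal_mult[symmetric] exp_add[symmetric])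
qed

text \<open>Different levels use disjoint sets of clocks. Each level succeeds with probability
  \<open>q = exp (- card J)\<close>, so the first \<open>N\<close> levels from \<open>K\<close> on
  all fail with probability \<open>(1 - q) ^ N\<close>, which tends to 0.\<close>

lemma AE_unbounded_records:
  assumes "finite J"
  shows "AE w in clock_space. \<forall>K. \<exists>m\<ge>K. \<forall>j\<in>J. 1 < w (j, m :: int)"
  unfolding AE_all_countable
proof
  fix K :: int
  define good where "good m = {w :: clocks. \<forall>j\<in>J. 1 < w (j, K + int m)}" for m
  define bad where "bad N = {w. \<forall>m\<in>{..<N}. w \<notin> good m}" for N
  define q where "q = exp (- real (card J))"
  have "Measurable.pred clock_space (\<lambda>w. w \<in> good m)" for m
    unfolding good_def using assms
    by (auto intro!: pred_intros_finite borel_measurable_pred_less measurable_clock)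
  then have good [measurable]: "good m \<in> sets clock_space" for m
    by (simp add: pred_def)
  then have bad [measurable]: "bad N \<in> sets clock_space" for N
  proof -
    have "Measurable.pred clock_space (\<lambda>w. \<forall>m\<in>{..<N}. w \<notin> good m)"
      by measurable
    then show ?thesis by (simp add: pred_def bad_def)
  qed
  have bad_measure: "measure clock_space (bad N) = (1 - q) ^ N" for N
  proof (induction N)
    case 0
    then show ?case using clock_space.prob_space by (simp add: bad_def)
  next
    case (Suc N)
    let ?C = "(\<lambda>j. (j, K + int N)) ` J"
    \<comment> \<open>\<open>bad N\<close> reads only levels below \<open>K + N\<close>, so running
      down the clocks at level \<open>K + N\<close> does not affect it. This turns lack of memory
      into independence of \<open>bad N\<close> and \<open>good N\<close>.\<close>
    have inv: "run_down ?C (\<lambda>_. 1) w \<in> bad N \<longleftrightarrow> w \<in> bad N" for w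
    proof -
      have "run_down ?C (\<lambda>_. 1) w (j, K + int m) = w (j, K + int m)" if "m < N" for j m
        using that by (auto simp: run_down_def)
      then show ?thesis by (simp add: bad_def good_def)
    qed
    have "emeasure clock_space (bad N \<inter> good N) =
        (\<integral>\<^sup>+w. (if \<forall>c\<in>?C. w c \<in> {1<..} then indicator (bad N) (run_down ?C (\<lambda>_. 1) w) else 0) \<partial>clock_space)"
      by (subst nn_integral_indicator[symmetric])
         (auto intro!: nn_integral_cong simp: inv good_def split: split_indicator simp del: nn_integral_indicator)
    also have "\<dots> = ennreal (exp (- (\<Sum>c\<in>?C. 1))) * emeasure clock_space (bad N)"
      using assms by (subst clock_space_memoryless[where b = "\<lambda>_. 1"]) auto
    also have "(\<Sum>c\<in>?C. 1 :: real) = real (card J)"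
      by (simp add: card_image inj_on_def)
    finally have "measure clock_space (bad N \<inter> good N) = q * measure clock_space (bad N)"
      by (simp add: clock_space.emeasure_eq_measure ennreal_mult[symmetric] q_def)
    moreover have "bad (Suc N) = bad N - bad N \<inter> good N"
      by (auto simp: bad_def less_Suc_eq)
    ultimately show ?case
      by (simp add: clock_space.finite_measure_Diff Suc algebra_simps)
  qed
  have "(\<Inter>N. bad N) \<in> null_sets clock_space"
  proof (rule null_setsI)
    have "(\<lambda>N. (1 - q) ^ N) \<longlonglongrightarrow> 0"
      by (rule LIMSEQ_realpow_zero) (auto simp: q_def)
    moreover have "measure clock_space (\<Inter>N. bad N) \<le> (1 - q) ^ N" for N
      unfolding bad_measure[symmetric] by (intro clock_space.finite_measure_mono) auto
    ultimately have "measure clock_space (\<Inter>N. bad N) \<le> 0"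
      by (intro LIMSEQ_le_const) auto
    then show "emeasure clock_space (\<Inter>N. bad N) = 0"
      by (simp add: clock_space.emeasure_eq_measure measure_le_0_iff)
  qed auto
  then show "AE w in clock_space. \<exists>m\<ge>K. \<forall>j\<in>J. 1 < w (j, m)"
  proof (rule AE_I')
    show "{w \<in> space clock_space. \<not> (\<exists>m\<ge>K. \<forall>j\<in>J. 1 < w (j, m))} \<subseteq> (\<Inter>N. bad N)"
      by (auto simp: bad_def good_def)
  qed
qed

section \<open>Bricks laid at clock rings\<close>

type_synonym profile = "int \<Rightarrow> int"

definition grow :: "int \<Rightarrow> profile \<Rightarrow> profile" where
  "grow i h = h(i := h i + 1)"

lemma grow_inject: "grow i h = grow j h \<longleftrightarrow> i = j"
proof
  assume "grow i h = grow j h"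
  then have "grow i h i = grow j h i" by simp
  then show "i = j" by (auto simp: grow_def split: if_splits)
qed simp

locale brick_rates =
  fixes r :: "int \<Rightarrow> real"
  assumes rate_pos: "0 < r z" and rate_mono: "strict_mono r"
begin

definition column_rate :: "profile \<Rightarrow> int \<Rightarrow> real" where
  "column_rate h i = r (h (i - 1) - h i) + r (h (i + 1) - h i)"

definition total_rate :: "int set \<Rightarrow> profile \<Rightarrow> real" where
  "total_rate J h = (\<Sum>i\<in>J. column_rate h i)"

text \<open>The counterpart of \<open>monotone_rate\<close> for heights; by
  \<open>grow_inject\<close> the sum has at most one term.\<close>

definition growth_rate :: "int set \<Rightarrow> profile \<Rightarrow> profile \<Rightarrow> real" where
  "growth_rate J h h' = (\<Sum>i\<in>{i \<in> J. h' = grow i h}. column_rate h i)"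

definition ring_time :: "profile \<Rightarrow> clocks \<Rightarrow> int \<Rightarrow> real" where
  "ring_time h w i = w (i, h i) / column_rate h i"

definition holding :: "int set \<Rightarrow> profile \<Rightarrow> clocks \<Rightarrow> real" where
  "holding J h w = Min (ring_time h w ` J)"

definition next_column :: "int set \<Rightarrow> profile \<Rightarrow> clocks \<Rightarrow> int" where
  "next_column J h w = Min {i \<in> J. \<forall>j\<in>J. ring_time h w i \<le> ring_time h w j}"

definition age :: "int set \<Rightarrow> profile \<Rightarrow> clocks \<Rightarrow> clocks" where
  "age J h w = run_down ((\<lambda>i. (i, h i)) ` J) (\<lambda>(i, k). column_rate h i * holding J h w) w"

text \<open>Keeping the residual clocks in the state makes the path an iterate of one map. After the
  first jump the same construction starts again from other data (\<open>height_at_shift\<close>),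
  which serves the law and measurability; the pathwise arguments split off the last jump instead
  (\<open>height_at_Suc\<close>).\<close>

definition evolve :: "int set \<Rightarrow> profile \<times> clocks \<Rightarrow> profile \<times> clocks" where
  "evolve J = (\<lambda>(h, w). (grow (next_column J h w) h, age J h w))"

definition height_at :: "int set \<Rightarrow> profile \<Rightarrow> clocks \<Rightarrow> nat \<Rightarrow> profile" where
  "height_at J h w n = fst ((evolve J ^^ n) (h, w))"

definition clock_at :: "int set \<Rightarrow> profile \<Rightarrow> clocks \<Rightarrow> nat \<Rightarrow> clocks" where
  "clock_at J h w n = snd ((evolve J ^^ n) (h, w))"

definition hold_at :: "int set \<Rightarrow> profile \<Rightarrow> clocks \<Rightarrow> nat \<Rightarrow> real" where
  "hold_at J h w n = holding J (height_at J h w n) (clock_at J h w n)"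

lemma column_rate_pos: "0 < column_rate h i"
  using rate_pos[of "h (i - 1) - h i"] rate_pos[of "h (i + 1) - h i"]
  by (simp add: column_rate_def)

lemma total_rate_pos: "finite J \<Longrightarrow> J \<noteq> {} \<Longrightarrow> 0 < total_rate J h"
  by (auto simp: total_rate_def intro!: sum_pos column_rate_pos)

lemma holding_le: "finite J \<Longrightarrow> i \<in> J \<Longrightarrow> holding J h w \<le> ring_time h w i"
  by (simp add: holding_def)

lemma next_column:
  assumes "finite J" "J \<noteq> {}"
  shows next_column_in: "next_column J h w \<in> J"
    and holding_eq: "holding J h w = ring_time h w (next_column J h w)"
proof -
  let ?A = "{i \<in> J. \<forall>j\<in>J. ring_time h w i \<le> ring_time h w j}"
  have "?A \<noteq> {}"
    using ex_is_arg_min_if_finite[OF assms, of "ring_time h w"]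
    by (auto simp: is_arg_min_linorder)
  then have *: "next_column J h w \<in> ?A"
    unfolding next_column_def using assms by (intro Min_in) auto
  then show "next_column J h w \<in> J" by simp
  show "holding J h w = ring_time h w (next_column J h w)"
    unfolding holding_def using * assms by (intro Min_eqI) auto
qed

text \<open>Each condition compares \<open>i\<close> with one other column. Once the clock of
  \<open>i\<close> is fixed, the event restricts the other clocks separately, as
  \<open>clock_space_memoryless\<close> requires.\<close>

lemma next_column_eq_iff:
  assumes "finite J" "i \<in> J"
  shows "next_column J h w = i \<longleftrightarrow>
    (\<forall>j\<in>J - {i}. if j < i then ring_time h w i < ring_time h w j else ring_time h w i \<le> ring_time h w j)"
    (is "_ \<longleftrightarrow> ?P")
proof
  let ?A = "{i \<in> J. \<forall>j\<in>J. ring_time h w i \<le> ring_time h w j}"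
  have J: "J \<noteq> {}" using assms by auto
  {
    assume n: "next_column J h w = i"
    have "ring_time h w i \<le> ring_time h w j" if "j \<in> J" for j
      using holding_le[OF assms(1) that, of h w] holding_eq[OF assms(1) J, of h w] n by simp
    moreover have "ring_time h w i < ring_time h w j" if "j \<in> J" "j < i" for j
    proof (rule ccontr)
      assume "\<not> ring_time h w i < ring_time h w j"
      then have "j \<in> ?A" using calculation that by force
      then have "i \<le> j"
        using assms(1) n by (auto simp: next_column_def intro: Min_le)
      then show False using that by simp
    qed
    ultimately show ?P by auto
  next
    assume P: ?P
    have "ring_time h w i \<le> ring_time h w j" if "j \<in> J" for j
      using P that by (cases "j = i") (auto dest!: bspec[of _ _ j] split: if_splits)
    then have "i \<in> ?A" using assms(2) by blast
    moreover have "i \<le> j" if "j \<in> ?A" for j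
      using that P assms(2) by (force simp: not_less[symmetric])
    ultimately show "next_column J h w = i"
      unfolding next_column_def using assms(1) by (intro Min_eqI) auto
  }
qed

lemma height_at_0 [simp]: "height_at J h w 0 = h"
  and clock_at_0 [simp]: "clock_at J h w 0 = w"
  and hold_at_0 [simp]: "hold_at J h w 0 = holding J h w"
  by (simp_all add: height_at_def clock_at_def hold_at_def)

lemma height_at_shift: "height_at J h w (Suc n) = height_at J (grow (next_column J h w) h) (age J h w) n"
  and clock_at_shift: "clock_at J h w (Suc n) = clock_at J (grow (next_column J h w) h) (age J h w) n"
  by (simp_all add: height_at_def clock_at_def evolve_def funpow_swap1)

lemma hold_at_shift: "hold_at J h w (Suc n) = hold_at J (grow (next_column J h w) h) (age J h w) n"
  by (simp add: hold_at_def height_at_shift clock_at_shift)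

lemma height_at_Suc:
    "height_at J h w (Suc n) = grow (next_column J (height_at J h w n) (clock_at J h w n)) (height_at J h w n)"
  and clock_at_Suc: "clock_at J h w (Suc n) = age J (height_at J h w n) (clock_at J h w n)"
  by (simp_all add: height_at_def clock_at_def evolve_def split_beta)

section \<open>Measurability of the path\<close>

lemma measurable_ring_time: "(\<lambda>w. ring_time h w i) \<in> borel_measurable clock_space"
  unfolding ring_time_def by (intro borel_measurable_divide measurable_clock) auto

lemma measurable_holding [measurable]:
  "finite J \<Longrightarrow> holding J h \<in> borel_measurable clock_space"
  unfolding holding_def by (intro borel_measurable_Min measurable_ring_time)

lemma measurable_next_column [measurable]:
  assumes "finite J" "J \<noteq> {}"
  shows "next_column J h \<in> clock_space \<rightarrow>\<^sub>M count_space UNIV"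
proof (subst measurable_count_space_eq2_countable, safe)
  fix i
  note [measurable] = measurable_ring_time
  have "{w. next_column J h w = i} \<in> sets clock_space"
  proof (cases "i \<in> J")
    case True
    have "Measurable.pred clock_space
        (\<lambda>w. if j < i then ring_time h w i < ring_time h w j else ring_time h w i \<le> ring_time h w j)" for j
      by (cases "j < i") (simp_all add: not_less[symmetric] del: not_less)
    then have "Measurable.pred clock_space (\<lambda>w. next_column J h w = i)"
      unfolding next_column_eq_iff[OF assms(1) True] using assms(1)
      by (intro pred_intros_finite) auto
    then show ?thesis by (simp add: pred_def)
  next
    case False
    then have "{w. next_column J h w = i} = {}" using next_column_in[OF assms] by auto
    then show ?thesis by simp
  qed
  then show "next_column J h -` {i} \<inter> space clock_space \<in> sets clock_space"
    by (simp add: vimage_def)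
qed auto

lemma measurable_age [measurable]:
  assumes "finite J"
  shows "age J h \<in> clock_space \<rightarrow>\<^sub>M clock_space"
proof (rule measurable_into_clock_space)
  fix c
  note [measurable] = assms measurable_clock[of c]
  show "(\<lambda>w. age J h w c) \<in> borel_measurable clock_space"
    unfolding age_def run_down_def by (cases c) simp
qed

lemma measurable_height_at [measurable]:
  assumes "finite J" "J \<noteq> {}"
  shows "(\<lambda>w. height_at J h w n) \<in> clock_space \<rightarrow>\<^sub>M count_space UNIV"
proof (induction n arbitrary: h)
  case (Suc n)
  note [measurable] = assms
  show ?case
    \<comment> \<open>With the first jump split off, the random index is a column, hence of the
      countable type \<open>int\<close>. The profile before the last jump would range over an
      uncountable type.\<close>
    unfolding height_at_shift
    by (rule measurable_compose_countable[OF measurable_compose[OF measurable_age Suc] measurable_next_column])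
       (use assms in auto)
qed simp

lemma measurable_hold_at [measurable]:
  assumes "finite J" "J \<noteq> {}"
  shows "(\<lambda>w. hold_at J h w n) \<in> borel_measurable clock_space"
proof (induction n arbitrary: h)
  case (Suc n)
  show ?case
    unfolding hold_at_shift
    by (rule measurable_compose_countable[OF measurable_compose[OF measurable_age Suc] measurable_next_column])
       (use assms in auto)
qed (simp add: assms)

text \<open>Fix the value \<open>a\<close> of the clock of \<open>i\<close>, which then rings at
  \<open>t = a / column_rate h i\<close>. Up to ties, \<open>i\<close> is first exactly if each
  other clock survives \<open>column_rate h j * t\<close>. Lack of memory makes those clocks fresh
  again at the price of \<open>exp (- (k * a))\<close>, and integrating over \<open>a\<close> gives
  the usual competition of exponential times. The clock of \<open>i\<close> is left at 0, hence the
  invariance of \<open>f\<close>.\<close>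

lemma first_jump:
  assumes "finite J" "i \<in> J" and [measurable]: "f \<in> borel_measurable clock_space"
    and f: "\<And>w a. f (w((i, h i) := a)) = f w"
  shows "(\<integral>\<^sup>+w. (if next_column J h w = i \<and> s < holding J h w then f (age J h w) else 0) \<partial>clock_space) =
    ennreal (column_rate h i / total_rate J h * exp (- (total_rate J h * max 0 s))) * (\<integral>\<^sup>+w. f w \<partial>clock_space)"
    (is "(\<integral>\<^sup>+w. ?F w \<partial>_) = _")
proof -
  have J: "J \<noteq> {}" using assms by auto
  note [measurable] = assms(1)
  define c where "c = (i, h i)"
  define C where "C = (\<lambda>j. (j, h j)) ` (J - {i})"
  define B :: "real \<Rightarrow> int \<times> int \<Rightarrow> real set" where
    "B t = (\<lambda>(j, k). if j < i then {column_rate h j * t<..} else {column_rate h j * t..})" for t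
  define b :: "real \<Rightarrow> int \<times> int \<Rightarrow> real" where "b t = (\<lambda>(j, k). column_rate h j * t)" for t
  define k where "k = (total_rate J h - column_rate h i) / column_rate h i"
  define I where "I = (\<integral>\<^sup>+w. f w \<partial>clock_space)"
  note pos = column_rate_pos[of h]
  have "0 \<le> (\<Sum>j\<in>J - {i}. column_rate h j)"
    by (intro sum_nonneg less_imp_le pos)
  moreover have total: "total_rate J h = column_rate h i + (\<Sum>j\<in>J - {i}. column_rate h j)"
    using assms(1,2) by (simp add: total_rate_def sum.remove)
  ultimately have k: "0 \<le> k"
    using pos[of i] by (simp add: k_def)
  have k1: "1 + k = total_rate J h / column_rate h i"
    using pos[of i] by (simp add: k_def field_simps)
  have [measurable]: "?F \<in> borel_measurable clock_space"
    using J by measurable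
  \<comment> \<open>For \<open>0 < a\<close> the ring time is positive, which allows
    \<open>s\<close> to be replaced by \<open>max 0 s\<close>.\<close>
  have F: "?F (w(c := a)) =
      (if max 0 s * column_rate h i < a
       then (if \<forall>d\<in>C. w d \<in> B (a / column_rate h i) d then f (run_down C (b (a / column_rate h i)) w) else 0)
       else 0)" if "0 < a" for w a
  proof -
    define t where "t = a / column_rate h i"
    have t: "0 < t" using that pos by (simp add: t_def)
    have ri: "ring_time h (w(c := a)) i = t"
      by (simp add: ring_time_def c_def t_def)
    have rj: "ring_time h (w(c := a)) j = w (j, h j) / column_rate h j" if "j \<noteq> i" for j
      using that by (simp add: ring_time_def c_def)
    have next_iff: "next_column J h (w(c := a)) = i \<longleftrightarrow> (\<forall>d\<in>C. w d \<in> B t d)"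
      unfolding next_column_eq_iff[OF assms(1,2)] ri C_def B_def using pos
      by (auto simp: rj field_simps)
    have hold: "holding J h (w(c := a)) = t" if "next_column J h (w(c := a)) = i"
      using holding_eq[OF assms(1) J] that ri by simp
    have "f (age J h (w(c := a))) = f (run_down C (b t) w)" if "next_column J h (w(c := a)) = i"
    proof -
      \<comment> \<open>\<open>age\<close> also runs down the clock of \<open>i\<close>; this is its
        only difference from \<open>run_down C (b t)\<close>, and \<open>f\<close> does not see
        it.\<close>
      have "run_down C (b t) w = (age J h (w(c := a)))(c := w c)"
        using pos[of i] hold[OF that] by (auto simp: fun_eq_iff age_def run_down_def C_def b_def c_def)
      then show ?thesis by (simp add: f c_def)
    qed
    moreover have "s < t \<longleftrightarrow> max 0 s * column_rate h i < a"
    proof -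
      have "s < t \<longleftrightarrow> max 0 s < t" using t by auto
      also have "\<dots> \<longleftrightarrow> max 0 s * column_rate h i < a"
        unfolding t_def using pos[of i] by (rule pos_less_divide_eq)
      finally show ?thesis .
    qed
    ultimately show ?thesis
      using next_iff hold by (auto simp: t_def)
  qed
  have sumC: "(\<Sum>d\<in>C. b (a / column_rate h i) d) = k * a" for a
  proof -
    have "(\<Sum>d\<in>C. b (a / column_rate h i) d) = (\<Sum>j\<in>J - {i}. column_rate h j * (a / column_rate h i))"
      unfolding C_def by (subst sum.reindex) (auto simp: inj_on_def b_def)
    also have "\<dots> = k * a"
      by (simp add: total k_def sum_distrib_right sum_divide_distrib)
    finally show ?thesis .
  qed
  have "(\<integral>\<^sup>+w. ?F w \<partial>clock_space) = (\<integral>\<^sup>+a. \<integral>\<^sup>+w. ?F (w(c := a)) \<partial>clock_space \<partial>exp_dist)"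
    by (rule nn_integral_resample) fact
  also have "\<dots> = (\<integral>\<^sup>+a. (if max 0 s * column_rate h i < a then ennreal (exp (- (k * a))) else 0) * I \<partial>exp_dist)"
  proof (rule nn_integral_cong_AE)
    show "AE a in exp_dist. (\<integral>\<^sup>+w. ?F (w(c := a)) \<partial>clock_space) =
        (if max 0 s * column_rate h i < a then ennreal (exp (- (k * a))) else 0) * I"
      using AE_exp_dist_pos
    proof eventually_elim
      case (elim a)
      have "(\<integral>\<^sup>+w. (if \<forall>d\<in>C. w d \<in> B (a / column_rate h i) d then f (run_down C (b (a / column_rate h i)) w) else 0) \<partial>clock_space)
         = ennreal (exp (- (\<Sum>d\<in>C. b (a / column_rate h i) d))) * I"
        unfolding I_def
        by (rule clock_space_memoryless)
           (use assms(1) elim pos in \<open>auto simp: C_def B_def b_def less_imp_le split: prod.splits\<close>)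
      then show ?case
        by (cases "max 0 s * column_rate h i < a") (simp_all add: F[OF elim] sumC)
    qed
  qed
  also have "\<dots> = (\<integral>\<^sup>+a. (if max 0 s * column_rate h i < a then ennreal (exp (- (k * a))) else 0) \<partial>exp_dist) * I"
    by (rule nn_integral_multc) measurable
  also have "(\<integral>\<^sup>+a. (if max 0 s * column_rate h i < a then ennreal (exp (- (k * a))) else 0) \<partial>exp_dist) =
      ennreal (exp (- ((1 + k) * (max 0 s * column_rate h i))) / (1 + k))"
    using pos[of i] k by (intro exp_dist_exp_integral) auto
  also have "exp (- ((1 + k) * (max 0 s * column_rate h i))) / (1 + k) =
      column_rate h i / total_rate J h * exp (- (total_rate J h * max 0 s))"
    using pos[of i] by (simp add: k1)
  finally show ?thesis unfolding I_def .
qed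

lemma first_jump_prob:
  assumes "finite J" "i \<in> J" and A [measurable]: "A \<in> sets clock_space"
    and inv: "\<And>w a. w((i, h i) := a) \<in> A \<longleftrightarrow> w \<in> A"
  shows "measure clock_space {w. next_column J h w = i \<and> s < holding J h w \<and> age J h w \<in> A} =
    column_rate h i / total_rate J h * exp (- (total_rate J h * max 0 s)) * measure clock_space A"
proof -
  have J: "J \<noteq> {}" using assms by auto
  note [measurable] = assms(1)
  have "Measurable.pred clock_space (\<lambda>w. next_column J h w = i \<and> s < holding J h w \<and> age J h w \<in> A)"
    using J by measurable
  then have [measurable]: "{w. next_column J h w = i \<and> s < holding J h w \<and> age J h w \<in> A} \<in> sets clock_space"
    by (simp add: pred_def)
  have "emeasure clock_space {w. next_column J h w = i \<and> s < holding J h w \<and> age J h w \<in> A} =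
      (\<integral>\<^sup>+w. indicator {w. next_column J h w = i \<and> s < holding J h w \<and> age J h w \<in> A} w \<partial>clock_space)"
    by simp
  also have "\<dots> =
      (\<integral>\<^sup>+w. (if next_column J h w = i \<and> s < holding J h w then indicator A (age J h w) else 0) \<partial>clock_space)"
    by (intro nn_integral_cong) (auto split: split_indicator)
  also have "\<dots> = ennreal (column_rate h i / total_rate J h * exp (- (total_rate J h * max 0 s))) * emeasure clock_space A"
    by (subst first_jump) (use assms in \<open>auto simp: inv split: split_indicator\<close>)
  finally show ?thesis
    using column_rate_pos[of h i] total_rate_pos[OF assms(1) J, of h]
    by (simp add: clock_space.emeasure_eq_measure ennreal_mult[symmetric])
qed

text \<open>
  After a jump of column i the clock at its old level is never read again. This is the invariance
  needed in \<open>first_jump_prob\<close>.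
\<close>

lemma path_local:
  assumes "finite J" "J \<noteq> {}" and "\<And>j k. h j \<le> k \<Longrightarrow> w (j, k) = w' (j, k)"
  shows "height_at J h w n = height_at J h w' n \<and> hold_at J h w n = hold_at J h w' n"
  using assms(3)
proof (induction n arbitrary: h w w')
  case 0
  have "ring_time h w = ring_time h w'" using 0 by (auto simp: ring_time_def)
  then show ?case by (simp add: holding_def)
next
  case (Suc n)
  have "ring_time h w = ring_time h w'" using Suc.prems by (auto simp: ring_time_def)
  then have eq: "holding J h w = holding J h w'" "next_column J h w = next_column J h w'"
    by (simp_all add: holding_def next_column_def)
  have "age J h w (j, k) = age J h w' (j, k)" if "grow (next_column J h w) h j \<le> k" for j k
    using Suc.prems[of j k] that by (auto simp: age_def run_down_def eq grow_def split: if_splits)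
  then show ?case
    using Suc.IH[of "grow (next_column J h w) h" "age J h w" "age J h w'"] by (simp add: height_at_shift hold_at_shift eq)
qed

text \<open>
  Negative \<open>s k\<close> are allowed in order to get the law of the jump chain alone from \<open>s k = -1\<close>.
\<close>

lemma path_law:
  assumes "finite J" "J \<noteq> {}"
  shows "measure clock_space {w. \<forall>k\<le>n. height_at J h w k = y k \<and> s k < hold_at J h w k} =
    (if y 0 = h then \<Prod>k<n. growth_rate J (y k) (y (Suc k)) / total_rate J (y k) else 0) *
    (\<Prod>k\<le>n. exp (- (total_rate J (y k) * max 0 (s k))))"
proof (induction n arbitrary: h y s)
  case 0
  note [measurable] = assms
  show ?case
  proof (cases "y 0 = h")
    case True
    \<comment> \<open>The event is cut according to the column that jumps first; the probabilities
      of these columns sum to 1.\<close>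
    have "measure clock_space {w. s 0 < holding J h w} =
        measure clock_space (\<Union>i\<in>J. {w. next_column J h w = i \<and> s 0 < holding J h w \<and> age J h w \<in> UNIV})"
      using next_column_in[OF assms] by (intro arg_cong[where f = "measure clock_space"]) auto
    also have "\<dots> = (\<Sum>i\<in>J. measure clock_space {w. next_column J h w = i \<and> s 0 < holding J h w \<and> age J h w \<in> UNIV})"
    proof (rule clock_space.finite_measure_finite_Union)
      have "Measurable.pred clock_space (\<lambda>w. next_column J h w = i \<and> s 0 < holding J h w \<and> age J h w \<in> UNIV)" for i
        by measurable
      then show "(\<lambda>i. {w. next_column J h w = i \<and> s 0 < holding J h w \<and> age J h w \<in> UNIV}) ` J \<subseteq> clock_space.events"
        by (auto simp: pred_def)
    qed (use assms in \<open>auto simp: disjoint_family_on_def\<close>)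
    also have "\<dots> = (\<Sum>i\<in>J. column_rate h i / total_rate J h * exp (- (total_rate J h * max 0 (s 0))))"
      by (intro sum.cong refl, subst first_jump_prob)
         (use assms clock_space.prob_space sets.top[of clock_space] in auto)
    also have "\<dots> = exp (- (total_rate J h * max 0 (s 0)))"
      using total_rate_pos[OF assms, of h]
      by (simp add: sum_distrib_right[symmetric] sum_divide_distrib[symmetric]) (simp add: total_rate_def)
    finally show ?thesis using True by simp
  next
    case False
    then have "{w. \<forall>k\<le>0. height_at J h w k = y k \<and> s k < hold_at J h w k} = {}" by auto
    with False show ?thesis by simp
  qed
next
  case (Suc n)
  note [measurable] = assms
  let ?E = "\<lambda>n h y s. {w. \<forall>k\<le>n. height_at J h w k = y k \<and> s k < hold_at J h w k}"
  have split: "w \<in> ?E (Suc n) h y s \<longleftrightarrow> h = y 0 \<and> s 0 < holding J h w \<and>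
      age J h w \<in> ?E n (grow (next_column J h w) h) (y \<circ> Suc) (s \<circ> Suc)" for w
    by (auto simp: All_less_Suc2 less_Suc_eq_le[symmetric] height_at_shift hold_at_shift simp del: less_Suc_eq_le)
  consider "y 0 \<noteq> h" | i where "y 0 = h" "i \<in> J" "y 1 = grow i h"
    | "y 0 = h" "\<forall>i\<in>J. y 1 \<noteq> grow i h" by blast
  then show ?case
  proof cases
    case 1
    then have "?E (Suc n) h y s = {}" by auto
    then show ?thesis using 1 by (simp only:) simp
  next
    case 2
    let ?A = "?E n (grow i h) (y \<circ> Suc) (s \<circ> Suc)"
    have "?E (Suc n) h y s = {w. next_column J h w = i \<and> s 0 < holding J h w \<and> age J h w \<in> ?A}"
    proof (intro set_eqI)
      fix w
      have "next_column J h w = i" if "w \<in> ?E (Suc n) h y s"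
        using that 2 height_at_shift[of J h w 0] by (auto simp: grow_inject dest!: spec[of _ 1])
      then show "w \<in> ?E (Suc n) h y s \<longleftrightarrow> w \<in> {w. next_column J h w = i \<and> s 0 < holding J h w \<and> age J h w \<in> ?A}"
        using split[of w] 2(1) by auto
    qed
    moreover have "measure clock_space {w. next_column J h w = i \<and> s 0 < holding J h w \<and> age J h w \<in> ?A} =
        column_rate h i / total_rate J h * exp (- (total_rate J h * max 0 (s 0))) * measure clock_space ?A"
    proof (rule first_jump_prob)
      have "Measurable.pred clock_space (\<lambda>w. \<forall>k\<in>{..n}. height_at J (grow i h) w k = (y \<circ> Suc) k \<and> (s \<circ> Suc) k < hold_at J (grow i h) w k)"
        by measurable
      then show "?A \<in> sets clock_space"
        by (simp add: pred_def Ball_def)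
      \<comment> \<open>After the jump column \<open>i\<close> is at level \<open>h i + 1\<close>,
        so the clock at level \<open>h i\<close> lies below the new profile, where
        \<open>path_local\<close> demands no agreement.\<close>
      show "w((i, h i) := a) \<in> ?A \<longleftrightarrow> w \<in> ?A" for w a
      proof -
        have "height_at J (grow i h) (w((i, h i) := a)) k = height_at J (grow i h) w k \<and>
            hold_at J (grow i h) (w((i, h i) := a)) k = hold_at J (grow i h) w k" for k
          by (rule path_local[OF assms]) (auto simp: grow_def split: if_splits)
        then show ?thesis by simp
      qed
    qed (use assms 2 in auto)
    moreover have "growth_rate J h (y 1) = column_rate h i"
    proof -
      have "{j \<in> J. y 1 = grow j h} = {i}" using 2 by (auto simp: grow_inject)
      then show ?thesis by (simp add: growth_rate_def)
    qed
    ultimately show ?thesis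
      unfolding prod.lessThan_Suc_shift prod.atMost_Suc_shift
      using 2 by (simp add: Suc.IH)
  next
    case 3
    have "?E (Suc n) h y s = {}"
    proof -
      have "height_at J h w 1 \<noteq> y 1" for w
        using 3 next_column_in[OF assms, of h w] height_at_shift[of J h w 0] by force
      then show ?thesis by auto
    qed
    moreover have "growth_rate J h (y 1) = 0"
    proof -
      have "{j \<in> J. y 1 = grow j h} = {}" using 3 by auto
      then show ?thesis by (simp only: growth_rate_def sum.empty)
    qed
    ultimately show ?thesis
      unfolding prod.lessThan_Suc_shift using 3 by (simp only:) simp
  qed
qed

section \<open>Non-explosion\<close>

definition jump_time :: "int set \<Rightarrow> profile \<Rightarrow> clocks \<Rightarrow> nat \<Rightarrow> real" where
  "jump_time J h w n = (\<Sum>k<n. hold_at J h w k)"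

text \<open>A jump time belongs to the new state. States with holding time 0, which arise when
  clocks ring together, are skipped.\<close>

definition profile_at :: "int set \<Rightarrow> profile \<Rightarrow> clocks \<Rightarrow> real \<Rightarrow> profile" where
  "profile_at J h w t = height_at J h w (LEAST n. t < jump_time J h w (Suc n))"

lemma jump_time_0 [simp]: "jump_time J h w 0 = 0"
  and jump_time_Suc: "jump_time J h w (Suc n) = jump_time J h w n + hold_at J h w n"
  by (simp_all add: jump_time_def)

text \<open>Higher neighbours increase both arguments of \<open>r\<close>. Equality at
  \<open>i\<close> is essential, as a higher column \<open>i\<close> would have smaller
  arguments.\<close>

lemma column_rate_mono:
  assumes "\<And>j. h j \<le> h' j" "h i = h' i"
  shows "column_rate h i \<le> column_rate h' i"
  using assms(1)[of "i - 1"] assms(1)[of "i + 1"] assms(2)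
  by (auto simp: column_rate_def intro!: add_mono monoD[OF strict_mono_mono[OF rate_mono]])

lemma column_rate_le:
  assumes "h (i - 1) \<le> h i" "h (i + 1) \<le> h i"
  shows "column_rate h i \<le> 2 * r 0"
  using monoD[OF strict_mono_mono[OF rate_mono], of "h (i - 1) - h i" 0]
    monoD[OF strict_mono_mono[OF rate_mono], of "h (i + 1) - h i" 0] assms
  by (simp add: column_rate_def)

lemma height_at_mono: "m \<le> n \<Longrightarrow> height_at J h w m i \<le> height_at J h w n i"
  by (rule lift_Suc_mono_le) (auto simp: height_at_Suc grow_def)

context
  fixes J :: "int set"
  assumes J: "finite J" "J \<noteq> {}"
begin

lemma holding_pos: "(\<And>c. 0 < w c) \<Longrightarrow> 0 < holding J h w"
  by (simp add: holding_eq[OF J] ring_time_def column_rate_pos)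

lemma height_at_frozen: "i \<notin> J \<Longrightarrow> height_at J h w n i = h i"
proof (induction n)
  case (Suc n)
  have "i \<noteq> next_column J (height_at J h w n) (clock_at J h w n)"
    using Suc.prems next_column_in[OF J] by metis
  with Suc show ?case by (simp add: height_at_Suc grow_def)
qed simp

text \<open>Infinitely many jumps cannot leave all columns of \<open>J\<close> bounded: this forces
  some column past the level chosen in \<open>jump_time_at_top\<close>.\<close>

lemma height_at_sum: "(\<Sum>i\<in>J. height_at J h w n i) = (\<Sum>i\<in>J. h i) + int n"
proof (induction n)
  case (Suc n)
  let ?i = "next_column J (height_at J h w n) (clock_at J h w n)"
  have "?i \<in> J" by (rule next_column_in[OF J])
  then show ?case
    using Suc J by (simp add: height_at_Suc grow_def sum.remove[of J ?i])
qed simp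

lemma age_active: "i \<in> J \<Longrightarrow> age J h w (i, h i) = w (i, h i) - column_rate h i * holding J h w"
  by (auto simp: age_def run_down_def)

lemma age_inactive: "k \<noteq> h i \<Longrightarrow> age J h w (i, k) = w (i, k)"
  by (auto simp: age_def run_down_def)

lemma column_rate_holding_le: "i \<in> J \<Longrightarrow> column_rate h i * holding J h w \<le> w (i, h i)"
  using holding_le[OF J(1), of i h w] column_rate_pos[of h i]
  by (simp add: ring_time_def pos_le_divide_eq mult.commute)

lemma column_rate_holding_next:
  "column_rate h (next_column J h w) * holding J h w = w (next_column J h w, h (next_column J h w))"
  using column_rate_pos[of h "next_column J h w"]
  by (simp add: holding_eq[OF J] ring_time_def)

lemma age_nonneg:
  assumes "\<And>c. 0 \<le> w c"
  shows "0 \<le> age J h w c"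
proof (cases c)
  case (Pair i k)
  then show ?thesis
    using assms[of c] column_rate_holding_le[of i h w]
    by (auto simp: age_def run_down_def)
qed

lemma holding_nonneg: "(\<And>c. 0 \<le> w c) \<Longrightarrow> 0 \<le> holding J h w"
  by (simp add: holding_eq[OF J] ring_time_def less_imp_le[OF column_rate_pos])

context
  fixes h :: profile and w :: clocks
  assumes w: "\<And>c. 0 < w c"
begin

lemma clock_at_nonneg: "0 \<le> clock_at J h w n c"
  by (induction n arbitrary: c) (auto simp: clock_at_Suc less_imp_le[OF w] intro: age_nonneg)

lemma hold_at_nonneg: "0 \<le> hold_at J h w n"
  unfolding hold_at_def by (intro holding_nonneg clock_at_nonneg)

lemma jump_time_mono: "m \<le> n \<Longrightarrow> jump_time J h w m \<le> jump_time J h w n"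
  by (rule lift_Suc_mono_le) (auto simp: jump_time_Suc hold_at_nonneg)

lemma jump_time_nonneg: "0 \<le> jump_time J h w n"
  using jump_time_mono[of 0 n] by simp

lemma jump_time_pos: "0 < n \<Longrightarrow> 0 < jump_time J h w n"
  using jump_time_mono[of 1 n] holding_pos[of w h] w by (simp add: jump_time_Suc)

lemma clock_at_le: "clock_at J h w n c \<le> w c"
proof (induction n)
  case (Suc n)
  obtain i k where c: "c = (i, k)" by (cases c)
  have "age J (height_at J h w n) (clock_at J h w n) c \<le> clock_at J h w n c"
    using hold_at_nonneg[of n] column_rate_pos[of "height_at J h w n" i]
    by (auto simp: age_def run_down_def c hold_at_def)
  with Suc show ?case by (simp add: clock_at_Suc)
qed simp

lemma clock_at_fresh: "height_at J h w n i < k \<Longrightarrow> clock_at J h w n (i, k) = w (i, k)"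
proof (induction n)
  case (Suc n)
  then show ?case
    using height_at_mono[of n "Suc n" J h w i] by (simp add: clock_at_Suc age_inactive)
qed simp

text \<open>Bounded jump times converge, so after some jump \<open>p\<close> less than
  \<open>1 / (2 * r 0)\<close> of time is left. One record level \<open>M\<close> above the heights
  at jump \<open>p\<close> contradicts this: the first column to pass \<open>M\<close> must use up a
  clock greater than 1 in the remaining time.\<close>

lemma jump_time_at_top:
  assumes records: "\<And>K. \<exists>M\<ge>K. \<forall>j\<in>J. 1 < w (j, M)"
  shows "filterlim (jump_time J h w) at_top sequentially"
proof (rule ccontr)
  let ?H = "height_at J h w" and ?W = "clock_at J h w" and ?T = "jump_time J h w"
  assume "\<not> filterlim ?T at_top sequentially"
  then obtain Z where Z: "\<not> (\<forall>\<^sub>F n in sequentially. Z \<le> ?T n)"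
    by (auto simp: filterlim_at_top)
  have TZ: "?T n \<le> Z" for n
  proof (rule ccontr)
    assume "\<not> ?T n \<le> Z"
    then have "\<forall>m\<ge>n. Z \<le> ?T m" using jump_time_mono by (meson le_less_trans less_imp_le not_le order_trans)
    with Z show False by (auto simp: eventually_sequentially)
  qed
  have "incseq ?T" using jump_time_mono by (simp add: incseq_def)
  then obtain t where t: "?T \<longlonglongrightarrow> t" "\<And>n. ?T n \<le> t"
    using incseq_convergent[of ?T Z] TZ by (metis incseq_le)
  have r0: "0 < 2 * r 0" using rate_pos[of 0] by simp
  obtain p where p: "t - 1 / (2 * r 0) < ?T p"
    using order_tendstoD(1)[OF t(1), of "t - 1 / (2 * r 0)"] r0 by (auto simp: eventually_sequentially)
  \<comment> \<open>The neighbours of \<open>J\<close> enter the rates of its columns. Those outside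
    \<open>J\<close> are frozen and stay below \<open>M\<close> forever.\<close>
  define near where "near = J \<union> (\<lambda>j. j - 1) ` J \<union> (\<lambda>j. j + 1) ` J"
  have near: "finite near" using J by (simp add: near_def)
  \<comment> \<open>Adding 1 keeps \<open>near\<close> strictly below \<open>M\<close> up to jump
    \<open>p\<close>, so that the clocks of \<open>J\<close> at level \<open>M\<close> are still
    full then.\<close>
  define K where "K = Max (?H p ` near) + 1"
  have K: "?H p i < K" if "i \<in> near" for i
    using near that by (simp add: K_def zless_add1_eq)
  obtain M where "K \<le> M" and M: "\<And>j. j \<in> J \<Longrightarrow> 1 < w (j, M)"
    using records by blast
  have "\<exists>n. \<exists>j\<in>J. M < ?H n j"
  proof (rule ccontr)
    assume "\<not> ?thesis"
    then have "(\<Sum>j\<in>J. ?H n j) \<le> (\<Sum>j\<in>J. M)" for n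
      by (intro sum_mono) (auto simp: not_less)
    then have "(\<Sum>j\<in>J. h j) + int n \<le> (\<Sum>j\<in>J. M)" for n
      by (simp only: height_at_sum)
    from this[of "nat ((\<Sum>j\<in>J. M) - (\<Sum>j\<in>J. h j) + 1)"] show False by linarith
  qed
  then obtain n where n: "\<exists>j\<in>J. M < ?H n j" "\<And>m. m < n \<Longrightarrow> \<not> (\<exists>j\<in>J. M < ?H m j)"
    using exists_least_iff[of "\<lambda>n. \<exists>j\<in>J. M < ?H n j"] by auto
  have below_p: "?H m i < M" if "m \<le> p" "i \<in> near" for m i
    using height_at_mono[OF that(1), of J h w i] K[OF that(2)] \<open>K \<le> M\<close> by simp
  have "p < n"
  proof (rule ccontr)
    assume "\<not> p < n"
    with n(1) below_p[of n] show False by (fastforce simp: near_def)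
  qed
  then obtain m where m: "n = Suc m" "p \<le> m" by (cases n) auto
  have below: "?H k i \<le> M" if "k \<le> m" "i \<in> near" for k i
  proof (cases "i \<in> J")
    case True
    then show ?thesis using n(2)[of k] that m by (auto simp: not_less)
  next
    case False
    then show ?thesis using below_p[of p i] that by (simp add: height_at_frozen)
  qed
  define j where "j = next_column J (?H m) (?W m)"
  have j: "j \<in> J" by (simp add: j_def next_column_in[OF J])
  have Hj: "?H m j = M"
  proof -
    obtain i where i: "i \<in> J" "M < ?H (Suc m) i" using n(1) m by auto
    then have "i = j"
      using below[of m i] by (auto simp: height_at_Suc grow_def j_def near_def split: if_splits)
    then show ?thesis
      using i below[of m i] by (auto simp: height_at_Suc grow_def j_def near_def)
  qed
  have slow: "column_rate (?H k) j \<le> 2 * r 0" if "k \<le> m" "?H k j = M" for k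
    using that j below[of k] by (intro column_rate_le) (auto simp: near_def)
  \<comment> \<open>After jump \<open>p\<close> the clock of \<open>j\<close> at level
    \<open>M\<close> loses at most \<open>2 * r 0\<close> per unit of time, and nothing while
    \<open>j\<close> is below \<open>M\<close>. Since it rings at the jump following state
    \<open>m\<close>, all of it is used up after jump \<open>p\<close>.\<close>
  have "p + k \<le> m \<Longrightarrow> w (j, M) - 2 * r 0 * (?T (p + k) - ?T p) \<le> ?W (p + k) (j, M)" for k
  proof (induction k)
    case 0
    have "j \<in> near" using j by (simp add: near_def)
    then show ?case using below_p[of p j] by (simp add: clock_at_fresh)
  next
    case (Suc k)
    show ?case
    proof (cases "?H (p + k) j = M")
      case True
      then have "column_rate (?H (p + k)) j * hold_at J h w (p + k) \<le> 2 * r 0 * hold_at J h w (p + k)"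
        using slow[of "p + k"] Suc.prems by (intro mult_right_mono hold_at_nonneg) auto
      moreover have "?W (p + Suc k) (j, M) = ?W (p + k) (j, M) - column_rate (?H (p + k)) j * hold_at J h w (p + k)"
        using age_active[OF j, of "?H (p + k)" "?W (p + k)"] True by (simp add: clock_at_Suc hold_at_def)
      ultimately show ?thesis
        using Suc by (simp add: jump_time_Suc algebra_simps)
    next
      case False
      then have "?W (p + Suc k) (j, M) = ?W (p + k) (j, M)"
        by (simp add: clock_at_Suc age_inactive)
      moreover have "0 \<le> 2 * r 0 * hold_at J h w (p + k)"
        using r0 hold_at_nonneg[of "p + k"] by simp
      ultimately show ?thesis
        using Suc by (simp add: jump_time_Suc algebra_simps)
    qed
  qed
  from this[of "m - p"] have "w (j, M) - 2 * r 0 * (?T m - ?T p) \<le> ?W m (j, M)"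
    using m by simp
  also have "?W m (j, M) = column_rate (?H m) j * hold_at J h w m"
    using column_rate_holding_next[of "?H m" "?W m"] by (simp add: j_def[symmetric] Hj hold_at_def)
  also have "\<dots> \<le> 2 * r 0 * hold_at J h w m"
    using slow[of m] Hj by (intro mult_right_mono hold_at_nonneg) auto
  finally have "w (j, M) \<le> 2 * r 0 * (?T (Suc m) - ?T p)"
    by (simp add: jump_time_Suc algebra_simps)
  also have "\<dots> \<le> 2 * r 0 * (t - ?T p)"
    using r0 t(2)[of "Suc m"] by (intro mult_left_mono) auto
  also have "\<dots> < 2 * r 0 * (1 / (2 * r 0))"
    using r0 p by (intro mult_strict_left_mono) auto
  finally show False using M[OF j] r0 by simp
qed

lemma jump_count:
  assumes "filterlim (jump_time J h w) at_top sequentially" and "0 \<le> t"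
  obtains n where "jump_time J h w n \<le> t" "t < jump_time J h w (Suc n)"
    and "profile_at J h w t = height_at J h w n"
proof
  let ?T = "jump_time J h w"
  define n where "n = (LEAST n. t < ?T (Suc n))"
  obtain m where "t < ?T m"
    using assms(1) by (auto simp: filterlim_at_top_dense eventually_sequentially)
  then have "t < ?T (Suc m)"
    using jump_time_mono[of m "Suc m"] by simp
  then show "t < ?T (Suc n)"
    unfolding n_def by (rule LeastI)
  show "?T n \<le> t"
  proof (cases n)
    case (Suc k)
    then have "\<not> t < ?T (Suc k)" using not_less_Least[of k "\<lambda>n. t < ?T (Suc n)"] by (simp add: n_def)
    with Suc show ?thesis by simp
  qed (simp add: assms(2))
qed (simp add: profile_at_def)

lemma profile_at_eq:
  assumes "jump_time J h w n \<le> t" "t < jump_time J h w (Suc n)"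
  shows "profile_at J h w t = height_at J h w n"
proof -
  have "(LEAST n. t < jump_time J h w (Suc n)) = n"
  proof (rule Least_equality)
    show "n \<le> m" if "t < jump_time J h w (Suc m)" for m
      using that assms(1) jump_time_mono[of "Suc m" n] by (force simp: not_le[symmetric])
  qed fact
  then show ?thesis by (simp add: profile_at_def)
qed

end

end

section \<open>Comparison of two intervals\<close>

text \<open>
  The two assumptions on n and m say essentially that the holding intervals of the n-th state of the
  small system and the m-th state of the large one overlap; the asymmetry (strict and weak) makes the
  large system jump first if both jump at the same time. The second claim compares the residual
  clocks of the columns that are equally high in both systems, which is what excludes that such a
  column rings in the small system first.
\<close>

lemma comparison_step:
  fixes J J' h w
  assumes J: "finite J" "J \<noteq> {}" and J': "finite J'" and "J \<subseteq> J'" and w: "\<And>c. 0 < w c"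
  defines "H \<equiv> height_at J h w" and "H' \<equiv> height_at J' h w"
    and "W \<equiv> clock_at J h w" and "W' \<equiv> clock_at J' h w"
    and "T \<equiv> jump_time J h w" and "T' \<equiv> jump_time J' h w"
  assumes "T n < T' (Suc m)" "T' m \<le> T (Suc n)"
  shows "(\<forall>i. H n i \<le> H' m i) \<and>
    (\<forall>t\<ge>max (T n) (T' m). \<forall>i\<in>J. H n i = H' m i \<longrightarrow>
      W' m (i, H n i) - column_rate (H' m) i * (t - T' m) \<le> W n (i, H n i) - column_rate (H n) i * (t - T n))"
  using assms(12,13)
proof (induction "n + m" arbitrary: n m rule: less_induct)
  case less
  let ?S = "hold_at J h w" and ?S' = "hold_at J' h w"
  let ?R = "\<lambda>n m t. \<forall>i\<in>J. H n i = H' m i \<longrightarrow>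
      W' m (i, H n i) - column_rate (H' m) i * (t - T' m) \<le> W n (i, H n i) - column_rate (H n) i * (t - T n)"
  have J'_ne: "J' \<noteq> {}" using J \<open>J \<subseteq> J'\<close> by auto
  note TS = jump_time_Suc[of J h w, folded T_def] jump_time_Suc[of J' h w, folded T'_def]
  \<comment> \<open>At equal height the large system runs down the clock at least as fast, so the
    second claim only has to be checked at the time \<open>max (T n) (T' m)\<close>.\<close>
  have age_later: "?R n m t" if "\<forall>i. H n i \<le> H' m i" "?R n m t0" "t0 \<le> t" for n m t0 t
  proof (intro ballI impI)
    fix i assume i: "i \<in> J" "H n i = H' m i"
    have "column_rate (H n) i * (t - t0) \<le> column_rate (H' m) i * (t - t0)"
      using that i by (intro mult_right_mono column_rate_mono) auto
    moreover have "W' m (i, H n i) - column_rate (H' m) i * (t0 - T' m) \<le> W n (i, H n i) - column_rate (H n) i * (t0 - T n)"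
      using that(2) i by blast
    ultimately show "W' m (i, H n i) - column_rate (H' m) i * (t - T' m) \<le> W n (i, H n i) - column_rate (H n) i * (t - T n)"
      by (simp add: algebra_simps)
  qed
  \<comment> \<open>The later of the two jumps that led to the states \<open>n\<close> and
    \<open>m\<close> is undone. In a tie it is the jump of the small system.\<close>
  consider (small) a where "n = Suc a" "T' m \<le> T n" | (large) b where "m = Suc b" "T n < T' m" | (start) "n = 0" "m = 0"
  proof (cases "T' m \<le> T n")
    case True
    show thesis
    proof (cases n)
      case 0
      then have "m = 0"
        using True jump_time_pos[where J = J' and w = w and h = h and n = m, OF J' J'_ne w]
        by (auto simp: T_def T'_def)
      with 0 show thesis using start by blast
    qed (use True small in blast)
  next
    case False
    then have "m \<noteq> 0"
      using jump_time_nonneg[where w = w and h = h and n = n, OF J w] by (cases m) (auto simp: T_def T'_def)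
    with False show thesis using large by (cases m) auto
  qed
  then show ?case
  proof cases
    case start
    have T0: "T 0 = 0" "T' 0 = 0"
      by (simp_all add: T_def T'_def)
    then have "?R 0 0 0"
      by (simp add: W_def W'_def H_def H'_def)
    moreover have "\<forall>i. H 0 i \<le> H' 0 i"
      by (simp add: H_def H'_def)
    ultimately show ?thesis
      using start T0 age_later[of 0 0 0] by auto
  next
    case small
    have "T a \<le> T n"
      using jump_time_mono[OF J w, of a n h] small by (simp add: T_def)
    then have IH: "\<forall>i. H a i \<le> H' m i" "\<forall>t\<ge>max (T a) (T' m). ?R a m t"
      using less.hyps[of a m] less.prems small by auto
    define c where "c = next_column J (H a) (W a)"
    have c: "c \<in> J" by (simp add: c_def next_column_in[OF J])
    have Hn: "H n = grow c (H a)" and Wn: "W n = age J (H a) (W a)"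
      using height_at_Suc[of J h w a] clock_at_Suc[of J h w a]
      by (simp_all add: small H_def W_def c_def)
    have R: "?R a m (T n)" using IH(2) \<open>T a \<le> T n\<close> small by simp
    \<comment> \<open>At equal height the residual clock of \<open>c\<close> in the large system
      would be at most 0 at time \<open>T n\<close>, as it is 0 in the small one. But it stays
      positive before \<open>T' (Suc m)\<close>, which is strictly later.\<close>
    have "H a c < H' m c"
    proof (rule ccontr)
      assume "\<not> H a c < H' m c"
      then have eq: "H a c = H' m c" using IH(1) by (auto simp: not_less intro: antisym)
      have "W' m (c, H a c) - column_rate (H' m) c * (T n - T' m) \<le> W a (c, H a c) - column_rate (H a) c * (T n - T a)"
        using R c eq by blast
      also have "\<dots> = 0"
        using column_rate_holding_next[OF J, of "H a" "W a"]
        by (simp add: small TS c_def[symmetric] hold_at_def flip: H_def W_def)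
      finally have "W' m (c, H' m c) \<le> column_rate (H' m) c * (T n - T' m)"
        by (simp add: eq)
      also have "\<dots> < column_rate (H' m) c * ?S' m"
        using less.prems(1) column_rate_pos[of "H' m" c] by (intro mult_strict_left_mono) (auto simp: TS)
      also have "\<dots> \<le> W' m (c, H' m c)"
        using column_rate_holding_le[OF J' J'_ne, of c "H' m" "W' m"] c \<open>J \<subseteq> J'\<close>
        by (auto simp: hold_at_def H'_def W'_def)
      finally show False by simp
    qed
    then have le: "\<forall>i. H n i \<le> H' m i"
      using IH(1) by (simp add: Hn grow_def)
    have "?R n m (T n)"
    proof (intro ballI impI)
      fix i assume i: "i \<in> J" "H n i = H' m i"
      show "W' m (i, H n i) - column_rate (H' m) i * (T n - T' m) \<le> W n (i, H n i) - column_rate (H n) i * (T n - T n)"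
      proof (cases "i = c")
        case True
        \<comment> \<open>Column \<open>c\<close> has just reached this level in the small system
          and has a full clock there; in the large system the same clock can only be
          smaller.\<close>
        have "W' m (i, H n i) \<le> w (i, H n i)"
          unfolding W'_def using w by (intro clock_at_le[OF J' J'_ne])
        also have "\<dots> = W n (i, H n i)"
        proof -
          have lt: "H a c < H n c" by (simp add: Hn grow_def)
          have "W a (c, H n c) = w (c, H n c)"
            using clock_at_fresh[where w = w and h = h and n = a and i = c and k = "H n c", OF J w] lt
            unfolding W_def H_def by blast
          moreover have "W n (c, H n c) = W a (c, H n c)"
            using lt by (simp add: Wn age_inactive[OF J])
          ultimately show ?thesis using True by simp
        qed
        finally have "W' m (i, H n i) \<le> W n (i, H n i)" .
        moreover have "0 \<le> column_rate (H' m) i * (T n - T' m)"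
          using small column_rate_pos[of "H' m" i] by (intro mult_nonneg_nonneg) auto
        ultimately show ?thesis by simp
      next
        case False
        then have "H a i = H n i" by (simp add: Hn grow_def)
        moreover have "W n (i, H a i) = W a (i, H a i) - column_rate (H a) i * (T n - T a)"
        proof -
          have "T n - T a = holding J (H a) (W a)"
            by (simp add: small TS hold_at_def H_def W_def)
          then show ?thesis using age_active[OF J i(1), of "H a" "W a"] by (simp add: Wn)
        qed
        ultimately show ?thesis using R i by simp
      qed
    qed
    then show ?thesis
      using le small age_later[of n m "T n"] by simp
  next
    case large
    have "T' b \<le> T' m"
      using jump_time_mono[OF J' J'_ne w, of b m h] large by (simp add: T'_def)
    then have IH: "\<forall>i. H n i \<le> H' b i" "\<forall>t\<ge>max (T n) (T' b). ?R n b t"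
      using less.hyps[of n b] less.prems large by auto
    define c where "c = next_column J' (H' b) (W' b)"
    have Hm: "H' m = grow c (H' b)" and Wm: "W' m = age J' (H' b) (W' b)"
      using height_at_Suc[of J' h w b] clock_at_Suc[of J' h w b]
      by (simp_all add: large H'_def W'_def c_def)
    have R: "?R n b (T' m)" using IH(2) \<open>T' b \<le> T' m\<close> large by simp
    have le: "\<forall>i. H n i \<le> H' m i"
      using IH(1) by (auto simp: Hm grow_def intro: order_trans)
    have "?R n m (T' m)"
    proof (intro ballI impI)
      fix i assume i: "i \<in> J" "H n i = H' m i"
      \<comment> \<open>Column \<open>c\<close> was at least as high in the large system and has
        grown, so it is now strictly higher and makes no claim on clocks.\<close>
      have "i \<noteq> c"
        using i(2) spec[OF IH(1), of c] by (auto simp: Hm grow_def)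
      then have "H' b i = H n i" using i by (simp add: Hm grow_def)
      moreover have "W' m (i, H' b i) = W' b (i, H' b i) - column_rate (H' b) i * (T' m - T' b)"
      proof -
        have "T' m - T' b = holding J' (H' b) (W' b)"
          by (simp add: large TS hold_at_def H'_def W'_def)
        then show ?thesis
          using age_active[OF J' J'_ne, of i "H' b" "W' b"] i(1) \<open>J \<subseteq> J'\<close> by (auto simp: Wm)
      qed
      ultimately show "W' m (i, H n i) - column_rate (H' m) i * (T' m - T' m) \<le> W n (i, H n i) - column_rate (H n) i * (T' m - T n)"
        using R i by auto
    qed
    then show ?thesis
      using le large age_later[of n m "T' m"] by simp
  qed
qed

text \<open>The states occupied at time \<open>t\<close> satisfy both conditions of
  \<open>comparison_step\<close>, because \<open>t\<close> lies in both holding intervals.\<close>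

lemma profile_at_mono:
  assumes "finite J" "J \<noteq> {}" "finite J'" "J \<subseteq> J'" and w: "\<And>c. 0 < w c"
    and T: "filterlim (jump_time J h w) at_top sequentially"
      "filterlim (jump_time J' h w) at_top sequentially"
    and "0 \<le> t"
  shows "profile_at J h w t i \<le> profile_at J' h w t i"
proof -
  have "J' \<noteq> {}" using assms by auto
  obtain n where n: "jump_time J h w n \<le> t" "t < jump_time J h w (Suc n)" "profile_at J h w t = height_at J h w n"
    using jump_count[OF assms(1,2) w T(1) \<open>0 \<le> t\<close>] .
  obtain m where m: "jump_time J' h w m \<le> t" "t < jump_time J' h w (Suc m)" "profile_at J' h w t = height_at J' h w m"
    using jump_count[OF assms(3) \<open>J' \<noteq> {}\<close> w T(2) \<open>0 \<le> t\<close>] .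
  show ?thesis
    using comparison_step[OF assms(1-4) w, where n = n and m = m and h = h] n m by auto
qed

end

section \<open>The coupling\<close>

definition increments :: "profile \<Rightarrow> config" where
  "increments h = (\<lambda>i. h (i - 1) - h i)"

lemma heights_increments: "h k = c \<Longrightarrow> heights k c (increments h) = h"
  by (rule heights_unique[symmetric]) (simp_all add: increments_def)

lemma increments_heights: "increments (heights k c \<eta>) = \<eta>"
  by (simp add: increments_def heights_increment)

lemma heights_inject: "heights k c \<eta> = heights k c \<eta>' \<longleftrightarrow> \<eta> = \<eta>'"
  by (metis increments_heights)

lemma lay_brick_inject: "lay_brick i \<eta> = lay_brick j \<eta> \<longleftrightarrow> i = j"
proof
  assume "lay_brick i \<eta> = lay_brick j \<eta>"
  then have "lay_brick i \<eta> i = lay_brick j \<eta> i" by simp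
  then show "i = j" by (auto simp: lay_brick_def split: if_splits)
qed simp

lemma tendsto_SUP_intervals:
  fixes f :: "int \<Rightarrow> int \<Rightarrow> 'a :: {complete_linorder, linorder_topology}"
  assumes mono: "\<And>L l u U. L \<le> l \<Longrightarrow> l < u \<Longrightarrow> u \<le> U \<Longrightarrow> f l u \<le> f L U"
  shows "((\<lambda>(l, u). f l u) \<longlongrightarrow> (SUP (l, u) \<in> {(l, u). l < u}. f l u)) (at_bot \<times>\<^sub>F at_top)"
proof (rule order_tendstoI)
  fix a assume "a < (SUP (l, u) \<in> {(l, u). l < u}. f l u)"
  then obtain l u where "l < u" and a: "a < f l u"
    by (auto simp: less_SUP_iff)
  have "\<forall>\<^sub>F x in at_bot \<times>\<^sub>F at_top. fst x \<le> l \<and> u \<le> snd x"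
    unfolding eventually_prod_filter
    by (rule exI[of _ "\<lambda>L. L \<le> l"], rule exI[of _ "\<lambda>U. u \<le> U"])
       (auto simp: eventually_le_at_bot eventually_ge_at_top)
  then show "\<forall>\<^sub>F x in at_bot \<times>\<^sub>F at_top. a < (case x of (l, u) \<Rightarrow> f l u)"
    by eventually_elim (use mono \<open>l < u\<close> a in \<open>auto simp: split_beta intro: less_le_trans\<close>)
next
  fix a assume a: "(SUP (l, u) \<in> {(l, u). l < u}. f l u) < a"
  \<comment> \<open>The bounds 0 and 1 force \<open>fst x < snd x\<close>; the supremum is over such
    pairs only.\<close>
  have "\<forall>\<^sub>F x in at_bot \<times>\<^sub>F at_top. fst x \<le> (0 :: int) \<and> (1 :: int) \<le> snd x"
    unfolding eventually_prod_filter
    by (rule exI[of _ "\<lambda>L. L \<le> 0"], rule exI[of _ "\<lambda>U. 1 \<le> U"])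
       (auto simp: eventually_le_at_bot eventually_ge_at_top)
  then show "\<forall>\<^sub>F x in at_bot \<times>\<^sub>F at_top. (case x of (l, u) \<Rightarrow> f l u) < a"
  proof eventually_elim
    case (elim x)
    then have "(case x of (l, u) \<Rightarrow> f l u) \<le> (SUP (l, u) \<in> {(l, u). l < u}. f l u)"
      by (intro SUP_upper) auto
    then show ?case using a by (rule le_less_trans)
  qed
qed

context brick_rates
begin

lemma column_rate_heights: "column_rate (heights k c x) i = r (x i) + r (- x (i + 1))"
proof -
  have "heights k c x (i + 1) - heights k c x i = - x (i + 1)"
    using heights_increment[of k c x "i + 1"] by simp
  then show ?thesis by (simp add: column_rate_def heights_increment)
qed

text \<open>The anchor \<open>l - 1\<close> lies outside the interval, so no brick is laid on it and
  \<open>lay_brick\<close> corresponds to \<open>grow\<close>. The height \<open>c\<close> is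
  arbitrary since rates depend on differences.\<close>

lemma monotone_rate_eq:
  "monotone_rate r l u x x' = growth_rate {l..<u} (heights (l - 1) c x) (heights (l - 1) c x')"
proof -
  have "{i. l \<le> i \<and> i \<le> u - 1 \<and> x' = lay_brick i x} =
      {i \<in> {l..<u}. heights (l - 1) c x' = grow i (heights (l - 1) c x)}"
    by (auto simp: grow_def heights_lay_brick[symmetric] heights_inject)
  then show ?thesis
    by (simp add: monotone_rate_def growth_rate_def column_rate_heights)
qed

lemma exit_rate_eq: "exit_rate (monotone_rate r l u) x = total_rate {l..<u} (heights (l - 1) c x)"
proof -
  let ?J = "{l..<u}"
  have "exit_rate (monotone_rate r l u) x = (\<Sum>\<^sub>\<infinity>x'\<in>(\<lambda>i. lay_brick i x) ` ?J. monotone_rate r l u x x')"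
    unfolding exit_rate_def
  proof (rule infsum_cong_neutral)
    fix x' assume "x' \<in> UNIV - (\<lambda>i. lay_brick i x) ` ?J"
    then have "{i. l \<le> i \<and> i \<le> u - 1 \<and> x' = lay_brick i x} = {}" by auto
    then show "monotone_rate r l u x x' = 0" by (simp only: monotone_rate_def sum.empty)
  qed auto
  also have "\<dots> = (\<Sum>i\<in>?J. monotone_rate r l u x (lay_brick i x))"
    by (simp add: sum.reindex inj_on_def lay_brick_inject)
  also have "\<dots> = total_rate ?J (heights (l - 1) c x)"
    unfolding total_rate_def
  proof (rule sum.cong)
    fix i assume "i \<in> ?J"
    then have "{j. l \<le> j \<and> j \<le> u - 1 \<and> lay_brick i x = lay_brick j x} = {i}"
      by (auto simp: lay_brick_inject)
    then show "monotone_rate r l u x (lay_brick i x) = column_rate (heights (l - 1) c x) i"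
      by (simp add: monotone_rate_def column_rate_heights)
  qed simp
  finally show ?thesis .
qed

lemma measurable_profile_at:
  assumes "finite J" "J \<noteq> {}"
  shows "(\<lambda>w. profile_at J h w t) \<in> clock_space \<rightarrow>\<^sub>M count_space UNIV"
  unfolding profile_at_def jump_time_def
proof (rule measurable_compose_countable)
  note [measurable] = assms
  show "(\<lambda>w. LEAST n. t < (\<Sum>k<Suc n. hold_at J h w k)) \<in> clock_space \<rightarrow>\<^sub>M count_space UNIV"
    by measurable
qed (use assms in measurable)

lemma measurable_increments:
  assumes "f \<in> clock_space \<rightarrow>\<^sub>M count_space UNIV"
  shows "(\<lambda>w. increments (f w)) \<in> clock_space \<rightarrow>\<^sub>M config_space"
  by (rule measurable_compose[OF assms]) (simp add: config_space_def space_PiM)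

text \<open>One event of full measure for all intervals and times, so that the coupling holds for
  all of them simultaneously.\<close>

definition regular :: "clocks \<Rightarrow> bool" where
  "regular w \<longleftrightarrow> (\<forall>c. 0 < w c) \<and> (\<forall>l u K. \<exists>m\<ge>K. \<forall>j\<in>{l..<u}. 1 < w (j, m))"

lemma AE_regular: "AE w in clock_space. regular w"
proof -
  have "AE w in clock_space. \<forall>l u. \<forall>K. \<exists>m\<ge>K. \<forall>j\<in>{l..<u}. 1 < w (j, m)"
    by (rule AE_all_countable[THEN iffD2], rule allI, rule AE_all_countable[THEN iffD2], rule allI)
       (rule AE_unbounded_records, simp)
  with AE_clock_pos show ?thesis
    by eventually_elim (auto simp: regular_def)
qed

lemma regular_pos: "regular w \<Longrightarrow> 0 < w c"
  by (cases c) (simp add: regular_def)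

lemma regular_jump_time:
  "regular w \<Longrightarrow> l < u \<Longrightarrow> filterlim (jump_time {l..<u} h w) at_top sequentially"
  by (intro jump_time_at_top) (auto simp: regular_def)

lemma column_height_profile_at:
  assumes "l < u"
  shows "column_height \<eta> l (increments (profile_at {l..<u} (heights 0 0 \<eta>) w t)) = profile_at {l..<u} (heights 0 0 \<eta>) w t"
  using height_at_frozen[of "{l..<u}" "l - 1"] assms
  by (auto simp: column_height_def profile_at_def intro!: heights_increments)

lemma monotone_process_profile_at:
  assumes "l < u" and h: "h = heights 0 0 \<eta>"
  shows "monotone_process clock_space r l u \<eta> (\<lambda>t w. increments (profile_at {l..<u} h w t))"
proof -
  let ?J = "{l..<u}"
  define Y where "Y n w = increments (height_at ?J h w n)" for n w
  define S where "S n w = hold_at ?J h w n" for n w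
  \<comment> \<open>Column \<open>l - 1\<close> keeps its initial height, so \<open>lift\<close>
    recovers the profile from its increments, and events of \<open>Y\<close> become events of the
    path of heights.\<close>
  define lift where "lift = heights (l - 1) (h (l - 1))"
  have J: "finite ?J" "?J \<noteq> {}" using assms by auto
  have frozen: "height_at ?J h w n (l - 1) = h (l - 1)" for w n
    using height_at_frozen[OF J] by simp
  have Y_eq: "Y n w = x \<longleftrightarrow> height_at ?J h w n = lift x" for n w x
    using heights_increments[of "height_at ?J h w n" "l - 1", OF frozen] increments_heights
    by (auto simp: Y_def lift_def)
  have lift_0: "lift x = h \<longleftrightarrow> x = \<eta>" for x
    using heights_increments[of h "l - 1" "h (l - 1)"] increments_heights
    by (metis h lift_def)
  have law: "measure clock_space {w. \<forall>k\<le>n. Y k w = x k \<and> s k < S k w} =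
      (if x 0 = \<eta> then \<Prod>k<n. monotone_rate r l u (x k) (x (Suc k)) / exit_rate (monotone_rate r l u) (x k) else 0) *
      (\<Prod>k\<le>n. exp (- (exit_rate (monotone_rate r l u) (x k) * max 0 (s k))))" for n x s
    using path_law[OF J, of n h "\<lambda>k. lift (x k)" s]
    unfolding Y_eq S_def lift_0 unfolding lift_def
    by (simp only: monotone_rate_eq[symmetric] exit_rate_eq[symmetric])
  have S_nonneg: "AE w in clock_space. \<forall>k. 0 \<le> S k w"
    using AE_clock_pos by eventually_elim (auto simp: S_def intro: hold_at_nonneg[OF J])
  have Y_measurable: "Y n \<in> clock_space \<rightarrow>\<^sub>M config_space" for n
    unfolding Y_def by (intro measurable_increments measurable_height_at J)
  have S_measurable: "S n \<in> borel_measurable clock_space" for n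
    unfolding S_def by (rule measurable_hold_at[OF J])
  have chain: "measure clock_space {w. \<forall>k\<le>n. Y k w = x k} =
      (if x 0 = \<eta> then \<Prod>k<n. monotone_rate r l u (x k) (x (Suc k)) / exit_rate (monotone_rate r l u) (x k) else 0)" for n x
  proof -
    note [measurable] = J measurable_height_at[OF J] measurable_hold_at[OF J]
    have sets: "{w. \<forall>k\<le>n. Y k w = x k} \<in> sets clock_space" "{w. \<forall>k\<le>n. Y k w = x k \<and> -1 < S k w} \<in> sets clock_space"
    proof -
      have "Measurable.pred clock_space (\<lambda>w. \<forall>k\<in>{..n}. height_at ?J h w k = lift (x k))"
        "Measurable.pred clock_space (\<lambda>w. \<forall>k\<in>{..n}. height_at ?J h w k = lift (x k) \<and> -1 < hold_at ?J h w k)"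
        by measurable
      then show "{w. \<forall>k\<le>n. Y k w = x k} \<in> sets clock_space" "{w. \<forall>k\<le>n. Y k w = x k \<and> -1 < S k w} \<in> sets clock_space"
        by (simp_all add: pred_def Ball_def Y_eq S_def)
    qed
    \<comment> \<open>Holding times are almost surely nonnegative, so the bound -1 adds no
      condition, and in \<open>law\<close> it gives the factor 1.\<close>
    have "measure clock_space {w. \<forall>k\<le>n. Y k w = x k} = measure clock_space {w. \<forall>k\<le>n. Y k w = x k \<and> -1 < S k w}"
    proof (rule clock_space.finite_measure_eq_AE[OF _ sets])
      show "AE w in clock_space. w \<in> {w. \<forall>k\<le>n. Y k w = x k} \<longleftrightarrow> w \<in> {w. \<forall>k\<le>n. Y k w = x k \<and> -1 < S k w}"
        using S_nonneg by eventually_elim (force intro: less_le_trans[of _ 0])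
    qed
    also have "\<dots> = (if x 0 = \<eta> then \<Prod>k<n. monotone_rate r l u (x k) (x (Suc k)) / exit_rate (monotone_rate r l u) (x k) else 0)"
      using law[where s = "\<lambda>_. -1"] by simp
    finally show ?thesis .
  qed
  have "jump_chain clock_space config_space (monotone_rate r l u) \<eta> Y"
    unfolding jump_chain_def using Y_measurable chain by simp
  moreover have "holding_times clock_space (monotone_rate r l u) Y S"
    unfolding holding_times_def using law chain S_measurable
    by (auto simp: max_absorb2 intro!: prod.cong)
  moreover have "AE w in clock_space. filterlim (\<lambda>n. \<Sum>k<n. S k w) at_top sequentially"
    using AE_regular
  proof eventually_elim
    case (elim w)
    then show ?case
      using regular_jump_time[OF elim \<open>l < u\<close>, of h] by (simp add: jump_time_def[abs_def] S_def)
  qed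
  moreover have "AE w in clock_space. \<forall>t\<ge>0. \<forall>n. (\<Sum>k<n. S k w) \<le> t \<and> t < (\<Sum>k<Suc n. S k w) \<longrightarrow>
      increments (profile_at ?J h w t) = Y n w"
    using AE_clock_pos
  proof eventually_elim
    case (elim w)
    then show ?case
      using profile_at_eq[OF J, of w h] by (auto simp: jump_time_def S_def Y_def)
  qed
  ultimately show ?thesis
    unfolding monotone_process_def markov_jump_process_def
    using measurable_increments[OF measurable_profile_at[OF J]] by blast
qed

end

theorem theorem2p2:
  fixes r :: "int \<Rightarrow> real" and \<eta> :: config
  assumes "\<And>z. 0 < r z"
    and "strict_mono r"
    and "\<And>z. r z * r (1 - z) = 1"
    and "filterlim r at_top at_top"
    and "\<exists>\<beta>>0. \<forall>z>0. r z < exp (\<beta> * real_of_int z)"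
  shows "\<exists>(M :: (int \<times> int \<Rightarrow> real) measure)
            (X :: int \<Rightarrow> int \<Rightarrow> real \<Rightarrow> (int \<times> int \<Rightarrow> real) \<Rightarrow> config).
    prob_space M \<and>
    (\<forall>l u. l < u \<longrightarrow> monotone_process M r l u \<eta> (X l u)) \<and>
    (AE w in M. \<forall>L l u U. L \<le> l \<and> l < 0 \<and> 0 < u \<and> u \<le> U \<longrightarrow>
       (\<forall>i. \<forall>t\<ge>0. column_height \<eta> l (X l u t w) i \<le> column_height \<eta> L (X L U t w) i)) \<and>
    (AE w in M. \<forall>i. \<forall>t\<ge>0.
       ((\<lambda>(l, u). ereal (real_of_int (column_height \<eta> l (X l u t w) i)))
          \<longlongrightarrow> (SUP (l, u) \<in> {(l, u). l < u}. ereal (real_of_int (column_height \<eta> l (X l u t w) i))))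
         (at_bot \<times>\<^sub>F at_top))"
proof -
  interpret brick_rates r using assms(1,2) by unfold_locales
  define h where "h = heights 0 0 \<eta>"
  define X where "X l u t w = increments (profile_at {l..<u} h w t)" for l u t w
  \<comment> \<open>Stated for all \<open>l < u\<close>, not only for intervals around 0, because
    the supremum ranges over all of them.\<close>
  have mono: "column_height \<eta> l (X l u t w) i \<le> column_height \<eta> L (X L U t w) i"
    if "regular w" "0 \<le> t" "L \<le> l" "l < u" "u \<le> U" for w t L l u U i
    using that profile_at_mono[of "{l..<u}" "{L..<U}" w h t i] regular_jump_time[of w _ _ h] regular_pos
    by (auto simp: X_def h_def column_height_profile_at)
  show ?thesis
  proof (intro exI conjI)
    show "prob_space clock_space" by (rule clock_space.prob_space_axioms)
    show "\<forall>l u. l < u \<longrightarrow> monotone_process clock_space r l u \<eta> (X l u)"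
      unfolding X_def using monotone_process_profile_at[OF _ h_def] by simp
    show "AE w in clock_space. \<forall>L l u U. L \<le> l \<and> l < 0 \<and> 0 < u \<and> u \<le> U \<longrightarrow>
       (\<forall>i. \<forall>t\<ge>0. column_height \<eta> l (X l u t w) i \<le> column_height \<eta> L (X L U t w) i)"
      using AE_regular by eventually_elim (auto intro: mono)
    show "AE w in clock_space. \<forall>i. \<forall>t\<ge>0.
       ((\<lambda>(l, u). ereal (real_of_int (column_height \<eta> l (X l u t w) i)))
          \<longlongrightarrow> (SUP (l, u) \<in> {(l, u). l < u}. ereal (real_of_int (column_height \<eta> l (X l u t w) i))))
         (at_bot \<times>\<^sub>F at_top)"
      using AE_regular
      by eventually_elim (auto intro!: tendsto_SUP_intervals mono)
  qed
qed

end
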